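(* Let $n\ge 2$, let $0<\delta,\tau<1$ and let $1<p,q<\infty$ be such that $1/p-1/q=\delta/n$. Then there exists a bounded domain $D$ in $\mathbb{R}^n$ with the following properties. (A) $D$ is an Ahlfors $n$-regular domain; in particular, there exists a constant $C_1>0$ such that the inequality $$\int_D |u(x)-u_D|^q\,dx\le C_1\biggl(\int_D\int_D\frac{|u(x)-u(y)|^p}{|x-y|^{n+\delta p}}\,dy\,dx\biggr)^{q/p}$$ holds for every $u\in L^p(D)$. (B) There is no constant $C_2>0$ such that the inequality $$\int_D |u(x)-u_D|\,dx\le C_2\biggl(\int_D\int_{B(x,\tau\,\mathrm{dist}(x,\partial D))}\frac{|u(x)-u(y)|^p}{|x-y|^{n+\delta p}}\,dy\,dx\biggr)^{1/p}$$ holds for every $u\in L^\infty(D)$. In particular, the improved fractional $(q,p)$-Poincaré inequality does not hold on $D$, i.e. there is no constant $C>0$ such that $$\int_D |u(x)-u_D|^q\,dx\le C\biggl(\int_D\int_{B(x,\tau\,\mathrm{dist}(x,\partial D))}\frac{|u(x)-u(y)|^p}{|x-y|^{n+\delta p}}\,dy\,dx\biggr)^{q/p}$$ holds for every $u\in L^\infty(D)$.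
   Context: A domain is a nonempty open connected set. $\mathrm{dist}(x,\partial D)$ is the distance from $x$ to the boundary of $D$, and $B(x,r)$ is the ball of center $x$ and radius $r$. For a measurable set $A$ of finite nonzero Lebesgue measure $|A|$, $u_A=|A|^{-1}\int_A u(x)\,dx$. Integrals on the right-hand sides are allowed to be $+\infty$, in which case the inequality is trivially true. A domain $G\subset\mathbb{R}^n$ is called Ahlfors $n$-regular if there exists a constant $C>0$ such that $|G\cap B(x,r)|\ge C r^n$ for every $x\in G$ and every $r\in(0,1]$. *)

theory Defs
  imports "HOL-Analysis.Analysis"
begin

definition euclid_domain :: "(real ^ 'n) set \<Rightarrow> bool" where
  "euclid_domain D \<longleftrightarrow> D \<noteq> {} \<and> open D \<and> connected D"

definition ahlfors_n_regular :: "(real ^ 'n) set \<Rightarrow> bool" where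
  "ahlfors_n_regular G \<longleftrightarrow>
     (\<exists>C>0. \<forall>x\<in>G. \<forall>r\<in>{0<..1}. measure lebesgue (G \<inter> ball x r) \<ge> C * r ^ CARD('n))"

definition Lp_on :: "(real ^ 'n) set \<Rightarrow> real \<Rightarrow> (real ^ 'n \<Rightarrow> real) set" where
  "Lp_on D p = {u. u \<in> borel_measurable (lebesgue_on D) \<and>
                   (\<integral>\<^sup>+x. ennreal (\<bar>u x\<bar> powr p) \<partial>lebesgue_on D) < \<infinity>}"

definition Linf_on :: "(real ^ 'n) set \<Rightarrow> (real ^ 'n \<Rightarrow> real) set" where
  "Linf_on D = {u. u \<in> borel_measurable (lebesgue_on D) \<and>
                   (\<exists>M. AE x in lebesgue_on D. \<bar>u x\<bar> \<le> M)}"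

definition avg :: "(real ^ 'n) set \<Rightarrow> (real ^ 'n \<Rightarrow> real) \<Rightarrow> real" where
  "avg A u = (LINT x|lebesgue_on A. u x) / measure lebesgue A"

text \<open>The powers of the possibly infinite right-hand sides; only exponents \<open>a > 0\<close> are meant.\<close>

definition enn_powr :: "ennreal \<Rightarrow> real \<Rightarrow> ennreal" where
  "enn_powr x a = (if x = \<infinity> then \<infinity> else ennreal (enn2real x powr a))"

text \<open>The double integral of \<open>|u(x) - u(y)|\<^sup>p / |x - y|\<^bsup>n + \<delta>p\<^esup>\<close> over \<open>x \<in> D\<close>, \<open>y \<in> N x\<close>.
  Isabelle's \<open>0 / 0 = 0\<close> gives the integrand the value \<open>0\<close> on the null set \<open>x = y\<close>.\<close>

definition frac_energy ::
  "(real ^ 'n) set \<Rightarrow> (real ^ 'n \<Rightarrow> (real ^ 'n) set) \<Rightarrow> real \<Rightarrow> real \<Rightarrow> (real ^ 'n \<Rightarrow> real) \<Rightarrow> ennreal"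
where
  "frac_energy D N \<delta> p u =
     (\<integral>\<^sup>+x. (\<integral>\<^sup>+y. ennreal (\<bar>u x - u y\<bar> powr p / norm (x - y) powr (real CARD('n) + \<delta> * p))
               \<partial>lebesgue_on (N x)) \<partial>lebesgue_on D)"

end

theory Submission
  imports Defs
begin

text \<open>
  The domain is a cylinder from which countably many walls of measure zero have been removed, at the
  heights $1/2, 1/4, 1/8, \dots$; each wall has a small round aperture on the axis.  The two parts of
  the theorem look at this set in different ways.

  For (A), only the measure counts, and up to a null set the domain is a convex body.  Contracting a
  convex body towards one of its points \<open>x\<close> gives subsets of diameter comparable to \<open>c\<close> and measure
  $c^n$ times the total.  This is Ahlfors regularity (\<open>ahlfors\<close>).  The same subsets give the
  fractional Sobolev--Poincare inequality at the critical exponent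
  (\<open>fractional_sobolev_poincare\<close>), by the argument of Hedberg: the difference between $u(x)$ and the
  average over the copy shrunk by $2^{-k}$ is controlled by $2^{-\delta k} h(x)^{1/p}$, where $h(x)$ is
  the inner integral of the energy $E$, and averages over successive copies differ by at most a multiple
  of $2^{kn/q} E^{1/p}$ (\<open>shrunk_averages_estimates\<close>).  Choosing the best $k$ at each point
  (\<open>geometric_interpolation\<close>) yields a pointwise bound whose $q$-th power integrates to $E^{q/p}$.

  For (B), the improved energy only compares points $x$ and $y$ where $y$ lies well inside the largest
  ball about $x$ in the domain.  Such a pair is separated by a wall only if the ball passes through the
  aperture, and then both points are within a multiple of its radius $\epsilon_j$ from its centre
  (\<open>crossing_near_aperture\<close>).  A function which is 1 below the wall and 0 above it, cut off near the
  aperture, therefore has improved energy at most a multiple of $\epsilon_j^{n - \delta p}$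
  (\<open>frac_energy_room_function_le\<close>), while its distance from every constant is bounded below
  in terms of the volumes on both sides (\<open>nn_integral_room_function_ge\<close>).  As
  $1/p - \delta/n = 1/q > 0$, the exponent $n - \delta p$ is positive, and apertures that shrink fast
  enough exclude any constant (\<open>no_improved_inequality\<close>).
\<close>

section \<open>Means of powers\<close>

text \<open>
  The graph of $t \mapsto t^p$ lies above its tangent at $b$, written without subtraction on the
  left.  It is Young's inequality for the factors $a$ and $b^{p-1}$.
\<close>

lemma powr_above_tangent:
  fixes a b p :: real
  assumes p: "1 < p" and "0 \<le> a" "0 \<le> b"
  shows "p * a * b powr (p - 1) \<le> a powr p + (p - 1) * b powr p"
proof -
  have "a * b powr (p - 1) \<le> a powr p / p + (b powr (p - 1)) powr (p / (p - 1)) / (p / (p - 1))"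
    using assms by (intro Youngs_inequality) (auto simp: field_simps)
  also have "(b powr (p - 1)) powr (p / (p - 1)) = b powr p"
    using p by (simp add: powr_powr)
  finally have "p * (a * b powr (p - 1)) \<le> p * (a powr p / p + b powr p / (p / (p - 1)))"
    using p by (intro mult_left_mono) auto
  moreover have "p * (a powr p / p + b powr p / (p / (p - 1))) = a powr p + (p - 1) * b powr p"
    using p by (simp add: distrib_left)
  ultimately show ?thesis by (simp add: mult.assoc)
qed

text \<open>
  Jensen's inequality for $|t|^p$: integrate the tangent inequality at the mean $b$ of $|w|$.  The
  right-hand side is stated as a nonnegative integral, which may be infinite.
\<close>

lemma (in finite_measure) powr_mean_le:
  fixes w :: "'a \<Rightarrow> real"
  assumes p: "1 < p" and w: "integrable M w" and pos: "0 < measure M (space M)"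
  shows "ennreal (measure M (space M) * \<bar>(LINT x|M. w x) / measure M (space M)\<bar> powr p)
    \<le> (\<integral>\<^sup>+x. ennreal (\<bar>w x\<bar> powr p) \<partial>M)"
proof (cases "(\<integral>\<^sup>+x. ennreal (\<bar>w x\<bar> powr p) \<partial>M) = \<infinity>")
  case False
  let ?m = "measure M (space M)"
  have [measurable]: "w \<in> borel_measurable M" using w by simp
  have ip: "integrable M (\<lambda>x. \<bar>w x\<bar> powr p)"
    using False by (intro integrableI_nonneg) (auto simp: top.not_eq_extremum)
  define b where "b = (LINT x|M. \<bar>w x\<bar>) / ?m"
  have b0: "0 \<le> b" by (simp add: b_def)
  have iw: "(LINT x|M. \<bar>w x\<bar>) = ?m * b" using pos by (simp add: b_def)
  have "(LINT x|M. p * \<bar>w x\<bar> * b powr (p - 1)) \<le> (LINT x|M. \<bar>w x\<bar> powr p + (p - 1) * b powr p)"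
    using w ip b0 p by (intro integral_mono powr_above_tangent) auto
  also have "\<dots> = (LINT x|M. \<bar>w x\<bar> powr p) + ?m * ((p - 1) * b powr p)"
    using ip by simp
  also have "(LINT x|M. p * \<bar>w x\<bar> * b powr (p - 1)) = p * (?m * b) * b powr (p - 1)"
    by (simp add: iw)
  also have "\<dots> = ?m * (p * b powr p)"
    using b0 p by (cases "b = 0") (auto simp: powr_diff)
  finally have 1: "?m * b powr p \<le> (LINT x|M. \<bar>w x\<bar> powr p)" by (simp add: algebra_simps)
  have "\<bar>(LINT x|M. w x) / ?m\<bar> \<le> b"
    using pos integral_abs_bound[of M w] by (simp add: b_def divide_right_mono)
  then have "?m * \<bar>(LINT x|M. w x) / ?m\<bar> powr p \<le> ?m * b powr p"
    using p by (intro mult_left_mono powr_mono2) auto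
  with 1 show ?thesis
    using ip by (simp add: nn_integral_eq_integral ennreal_leI)
qed simp

lemma powr_diff_avg_le:
  fixes A :: "(real ^ 'n) set"
  assumes p: "1 < p" and A: "A \<in> lmeasurable" "0 < measure lebesgue A"
    and u: "integrable (lebesgue_on A) u"
  shows "ennreal (measure lebesgue A * \<bar>c - avg A u\<bar> powr p)
    \<le> (\<integral>\<^sup>+x. ennreal (\<bar>c - u x\<bar> powr p) \<partial>lebesgue_on A)"
proof -
  interpret finite_measure "lebesgue_on A" by (rule finite_measure_lebesgue_on[OF A(1)])
  have m: "measure (lebesgue_on A) (space (lebesgue_on A)) = measure lebesgue A"
    using A by (simp add: measure_restrict_space)
  have eq: "(LINT x|lebesgue_on A. c - u x) / measure lebesgue A = c - avg A u"
    using A u m by (simp add: avg_def diff_divide_distrib)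
  show ?thesis
    using powr_mean_le[OF p, of "\<lambda>x. c - u x", unfolded m eq] A u by simp
qed

lemma integrable_lebesgue_on_subset:
  fixes u :: "real ^ 'n \<Rightarrow> real"
  assumes "integrable (lebesgue_on D) u" "A \<subseteq> D" "A \<in> sets lebesgue" "D \<in> sets lebesgue"
  shows "integrable (lebesgue_on A) u"
  using assms set_integrable_subset[of lebesgue D u A]
  by (simp add: integrable_restrict_space set_integrable_def)

lemma nn_integral_lebesgue_on_mono_set:
  assumes "A \<subseteq> D" "A \<in> sets lebesgue" "D \<in> sets lebesgue"
  shows "(\<integral>\<^sup>+x. f x \<partial>lebesgue_on A) \<le> (\<integral>\<^sup>+x. f x \<partial>lebesgue_on D)"
  using assms by (auto simp: nn_integral_restrict_space intro!: nn_integral_mono split: split_indicator)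

text \<open>
  On a set of finite measure $|u| \le 1 + |u|^p$ is integrable, so all averages below are genuine.
\<close>

lemma Lp_on_imp_integrable:
  fixes D :: "(real ^ 'n) set"
  assumes D: "D \<in> lmeasurable" and p: "1 < p" and u: "u \<in> Lp_on D p"
  shows "integrable (lebesgue_on D) u"
proof -
  interpret finite_measure "lebesgue_on D" by (rule finite_measure_lebesgue_on[OF D])
  have [measurable]: "u \<in> borel_measurable (lebesgue_on D)"
    and fin: "(\<integral>\<^sup>+x. ennreal (\<bar>u x\<bar> powr p) \<partial>lebesgue_on D) < \<infinity>"
    using u by (auto simp: Lp_on_def)
  have "integrable (lebesgue_on D) (\<lambda>x. \<bar>u x\<bar> powr p)"
    using fin by (intro integrableI_nonneg) auto
  then have "integrable (lebesgue_on D) (\<lambda>x. 1 + \<bar>u x\<bar> powr p)" by simp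
  moreover have "\<bar>t\<bar> \<le> 1 + \<bar>t\<bar> powr p" for t :: real
    using p powr_mono[of 1 p "\<bar>t\<bar>"] powr_ge_zero[of "\<bar>t\<bar>" p] by (cases "\<bar>t\<bar> \<le> 1"; simp; linarith)
  ultimately show ?thesis
    by (elim Bochner_Integration.integrable_bound) (auto simp: abs_of_nonneg add_nonneg_nonneg)
qed

section \<open>Conull subsets of bounded convex sets\<close>

text \<open>
  Regularity and the Sobolev--Poincare inequality see a set only up to null sets, whereas convexity can be
  destroyed by removing a null set.  The locale isolates what survives: \<open>D\<close> fills the convex
  set \<open>G\<close> up to measure zero.
\<close>

locale conull_in_convex =
  fixes D G :: "(real ^ 'n) set"
  assumes convex_G: "convex G" and bounded_G: "bounded G"
    and D_sets: "D \<in> sets lebesgue" and D_subset: "D \<subseteq> G"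
    and negligible_diff: "negligible (G - D)"
    and D_pos: "0 < measure lebesgue D"
begin

lemma D_lmeasurable: "D \<in> lmeasurable"
  using D_sets D_subset bounded_G bounded_set_imp_lmeasurable bounded_subset by blast

lemma G_lmeasurable: "G \<in> lmeasurable"
  by (rule measurable_convex[OF convex_G bounded_G])

lemma measure_D_eq: "measure lebesgue D = measure lebesgue G"
  by (rule measure_negligible_symdiff[OF G_lmeasurable])
     (use negligible_diff D_subset in \<open>simp add: Diff_eq_empty_iff[THEN iffD2]\<close>)

text \<open>
  The contraction by the factor \<open>c\<close> towards \<open>x\<close> is applied to \<open>G\<close>, which it maps into itself by
  convexity, and the result is intersected with \<open>D\<close>: the image of \<open>D\<close> itself could leave \<open>D\<close>.  These sets play the role of the balls of radius comparable to \<open>c\<close> about \<open>x\<close>.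
\<close>

definition shrunk :: "real ^ 'n \<Rightarrow> real \<Rightarrow> (real ^ 'n) set" where
  "shrunk x c = D \<inter> (\<lambda>y. c *\<^sub>R y + (1 - c) *\<^sub>R x) ` G"

lemma shrunk_subset: "shrunk x c \<subseteq> D"
  by (auto simp: shrunk_def)

lemma
  assumes x: "x \<in> G" and c: "0 < c" "c \<le> 1"
  shows shrunk_lmeasurable: "shrunk x c \<in> lmeasurable"
    and measure_shrunk: "measure lebesgue (shrunk x c) = c ^ CARD('n) * measure lebesgue D"
proof -
  let ?T = "(\<lambda>y. c *\<^sub>R y + (1 - c) *\<^sub>R x) ` G"
  have sub: "?T \<subseteq> G"
    using convex_G x c by (auto simp: convex_alt algebra_simps)
  have "convex ?T"
  proof -
    have "?T = (+) ((1 - c) *\<^sub>R x) ` (*\<^sub>R) c ` G" by (auto simp: image_image add.commute)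
    then show ?thesis using convex_translation[OF convex_scaling[OF convex_G]] by simp
  qed
  then have T: "?T \<in> lmeasurable"
    using measurable_convex bounded_subset[OF bounded_G sub] by blast
  have "negligible ((?T - shrunk x c) \<union> (shrunk x c - ?T))"
    by (rule negligible_subset[OF negligible_diff]) (use sub in \<open>auto simp: shrunk_def\<close>)
  from lmeasurable_negligible_symdiff[OF T this] measure_negligible_symdiff[OF T this]
  show "shrunk x c \<in> lmeasurable"
    "measure lebesgue (shrunk x c) = c ^ CARD('n) * measure lebesgue D"
    using measure_lebesgue_affine[of c "(1 - c) *\<^sub>R x" G] c by (auto simp: measure_D_eq)
qed

lemma norm_shrunk_le:
  assumes x: "x \<in> G" and c: "0 < c" and y: "y \<in> shrunk x c"
  shows "norm (x - y) \<le> c * diameter G"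
proof -
  obtain z where z: "z \<in> G" "y = c *\<^sub>R z + (1 - c) *\<^sub>R x" using y by (auto simp: shrunk_def)
  then have "x - y = c *\<^sub>R (x - z)" by (simp add: algebra_simps)
  moreover have "norm (x - z) \<le> diameter G"
    using diameter_bounded_bound[OF bounded_G x z(1)] by (simp add: dist_norm)
  ultimately show ?thesis using c by (simp add: mult_left_mono)
qed

lemma shrunk_one: "shrunk x 1 = D"
  using D_subset by (auto simp: shrunk_def)

text \<open>
  The set shrunk by \<open>r / d\<close> lies in the ball of radius \<open>r\<close> and has measure comparable to $r^n$.
\<close>

lemma ahlfors: "ahlfors_n_regular D"
  unfolding ahlfors_n_regular_def
proof (intro exI conjI ballI)
  \<comment> \<open>Adding 1 gives d at least 1, so that the ratio r / d is at most 1, and it makes the inclusion in the open ball strict.\<close>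
  define d where "d = diameter G + 1"
  have d: "1 \<le> d" using diameter_ge_0[OF bounded_G] by (simp add: d_def)
  show "0 < (1 / d) ^ CARD('n) * measure lebesgue D" using d D_pos by simp
  fix x r assume x: "x \<in> D" and r: "r \<in> {0<..1::real}"
  have xG: "x \<in> G" using x D_subset by auto
  have c: "0 < r / d" "r / d \<le> 1" using r d by auto
  have "shrunk x (r / d) \<subseteq> D \<inter> ball x r"
  proof
    fix y assume y: "y \<in> shrunk x (r / d)"
    have "norm (x - y) \<le> r / d * diameter G" by (rule norm_shrunk_le[OF xG c(1) y])
    also have "\<dots> < r / d * d" using c d by (intro mult_strict_left_mono) (auto simp: d_def)
    finally show "y \<in> D \<inter> ball x r"
      using y d by (auto simp: shrunk_def dist_norm)
  qed
  then have "measure lebesgue (shrunk x (r / d)) \<le> measure lebesgue (D \<inter> ball x r)"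
    using shrunk_lmeasurable[OF xG c] D_lmeasurable
    by (intro measure_mono_fmeasurable) (auto intro!: fmeasurable_Int_fmeasurable)
  then show "(1 / d) ^ CARD('n) * measure lebesgue D * r ^ CARD('n) \<le> measure lebesgue (D \<inter> ball x r)"
    by (simp add: measure_shrunk[OF xG c] power_divide field_simps)
qed


section \<open>The critical fractional Sobolev--Poincare inequality\<close>

text \<open>
  Jensen's inequality bounds the left-hand side by the integral of $|u(x)-u(y)|^p$ over \<open>A\<close>; on \<open>A\<close>
  the kernel $|x-y|^{-s}$ is at least $r^{-s}$ and may be inserted at the cost of $r^s$.  The point
  $y = x$ causes no trouble because the numerator vanishes there.
\<close>

lemma powr_diff_avg_le_energy:
  assumes p: "1 < p" and s: "0 < s" and u: "integrable (lebesgue_on D) u"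
    and A: "A \<in> lmeasurable" "A \<subseteq> D" "0 < measure lebesgue A"
    and r: "\<And>y. y \<in> A \<Longrightarrow> norm (x - y) \<le> r"
  shows "ennreal (measure lebesgue A * \<bar>u x - avg A u\<bar> powr p)
    \<le> ennreal (r powr s) * (\<integral>\<^sup>+y. ennreal (\<bar>u x - u y\<bar> powr p / norm (x - y) powr s) \<partial>lebesgue_on D)"
proof -
  have As: "A \<in> sets lebesgue" using A by (simp add: fmeasurableD)
  have uA: "integrable (lebesgue_on A) u"
    by (rule integrable_lebesgue_on_subset[OF u A(2) As D_sets])
  have [measurable]: "u \<in> borel_measurable (lebesgue_on D)" using u by simp
  have [measurable]: "(\<lambda>y. y) \<in> lebesgue_on D \<rightarrow>\<^sub>M borel"
    using id_borel_measurable_lebesgue_on[of D] by (simp add: id_def)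
  have "ennreal (measure lebesgue A * \<bar>u x - avg A u\<bar> powr p)
      \<le> (\<integral>\<^sup>+y. ennreal (\<bar>u x - u y\<bar> powr p) \<partial>lebesgue_on A)"
    by (rule powr_diff_avg_le[OF p A(1,3) uA])
  also have "\<dots> \<le> (\<integral>\<^sup>+y. ennreal (r powr s) * ennreal (\<bar>u x - u y\<bar> powr p / norm (x - y) powr s) \<partial>lebesgue_on A)"
  proof (rule nn_integral_mono)
    fix y assume "y \<in> space (lebesgue_on A)"
    then have y: "norm (x - y) \<le> r" using r by simp
    have "\<bar>u x - u y\<bar> powr p \<le> r powr s * (\<bar>u x - u y\<bar> powr p / norm (x - y) powr s)"
    proof (cases "x = y")
      case False
      then have "norm (x - y) powr s \<le> r powr s" using y s by (intro powr_mono2) auto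
      then show ?thesis using False
        by (simp add: field_simps mult_right_mono)
    qed simp
    then show "ennreal (\<bar>u x - u y\<bar> powr p)
        \<le> ennreal (r powr s) * ennreal (\<bar>u x - u y\<bar> powr p / norm (x - y) powr s)"
      by (simp add: ennreal_leI flip: ennreal_mult)
  qed
  also have "\<dots> \<le> (\<integral>\<^sup>+y. ennreal (r powr s) * ennreal (\<bar>u x - u y\<bar> powr p / norm (x - y) powr s) \<partial>lebesgue_on D)"
    by (rule nn_integral_lebesgue_on_mono_set[OF A(2) As D_sets])
  also have "\<dots> = ennreal (r powr s) * (\<integral>\<^sup>+y. ennreal (\<bar>u x - u y\<bar> powr p / norm (x - y) powr s) \<partial>lebesgue_on D)"
    by (rule nn_integral_cmult) measurable
  finally show ?thesis .
qed

lemma measurable_inner_energy: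
  assumes [measurable]: "u \<in> borel_measurable (lebesgue_on D)"
  shows "(\<lambda>x. \<integral>\<^sup>+y. ennreal (\<bar>u x - u y\<bar> powr p / norm (x - y) powr s) \<partial>lebesgue_on D)
    \<in> borel_measurable (lebesgue_on D)"
proof -
  interpret finite_measure "lebesgue_on D" by (rule finite_measure_lebesgue_on[OF D_lmeasurable])
  have [measurable]: "(\<lambda>y. y) \<in> lebesgue_on D \<rightarrow>\<^sub>M borel"
    using id_borel_measurable_lebesgue_on[of D] by (simp add: id_def)
  have [measurable]: "(\<lambda>z. fst z :: real ^ 'n) \<in> lebesgue_on D \<Otimes>\<^sub>M lebesgue_on D \<rightarrow>\<^sub>M borel"
    "(\<lambda>z. snd z :: real ^ 'n) \<in> lebesgue_on D \<Otimes>\<^sub>M lebesgue_on D \<rightarrow>\<^sub>M borel"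
    using measurable_compose[OF measurable_fst \<open>(\<lambda>y. y) \<in> lebesgue_on D \<rightarrow>\<^sub>M borel\<close>]
      measurable_compose[OF measurable_snd \<open>(\<lambda>y. y) \<in> lebesgue_on D \<rightarrow>\<^sub>M borel\<close>] by simp_all
  have "(\<lambda>z. ennreal (\<bar>u (fst z) - u (snd z)\<bar> powr p / norm (fst z - snd z) powr s))
      \<in> borel_measurable (lebesgue_on D \<Otimes>\<^sub>M lebesgue_on D)"
    by measurable
  then show ?thesis
    by (intro borel_measurable_nn_integral) (simp add: case_prod_beta')
qed

text \<open>
  The pointwise bound with $x$ running through \<open>B\<close>, combined with Jensen's inequality once more.
\<close>

lemma powr_diff_avgs_le_energy:
  assumes p: "1 < p" and s: "0 < s" and u: "integrable (lebesgue_on D) u"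
    and A: "A \<in> lmeasurable" "A \<subseteq> D" "0 < measure lebesgue A"
    and B: "B \<in> lmeasurable" "B \<subseteq> D" "0 < measure lebesgue B"
    and r: "\<And>x y. y \<in> A \<Longrightarrow> x \<in> B \<Longrightarrow> norm (x - y) \<le> r"
  shows "ennreal (measure lebesgue A * measure lebesgue B * \<bar>avg A u - avg B u\<bar> powr p)
    \<le> ennreal (r powr s) * (\<integral>\<^sup>+x. \<integral>\<^sup>+y. ennreal (\<bar>u x - u y\<bar> powr p / norm (x - y) powr s) \<partial>lebesgue_on D \<partial>lebesgue_on D)"
    (is "_ \<le> _ * (\<integral>\<^sup>+x. ?h x \<partial>_)")
proof -
  have Bs: "B \<in> sets lebesgue" using B by (simp add: fmeasurableD)
  have uB: "integrable (lebesgue_on B) u"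
    by (rule integrable_lebesgue_on_subset[OF u B(2) Bs D_sets])
  have uB_meas[measurable]: "u \<in> borel_measurable (lebesgue_on B)" using uB by simp
  have [measurable]: "u \<in> borel_measurable (lebesgue_on D)" using u by simp
  have "ennreal (measure lebesgue A * measure lebesgue B * \<bar>avg A u - avg B u\<bar> powr p)
     = ennreal (measure lebesgue A) * ennreal (measure lebesgue B * \<bar>avg A u - avg B u\<bar> powr p)"
    by (simp add: mult.assoc flip: ennreal_mult)
  also have "\<dots> \<le> ennreal (measure lebesgue A) * (\<integral>\<^sup>+x. ennreal (\<bar>avg A u - u x\<bar> powr p) \<partial>lebesgue_on B)"
    by (intro mult_left_mono powr_diff_avg_le[OF p B(1,3) uB]) auto
  also have "\<dots> = (\<integral>\<^sup>+x. ennreal (measure lebesgue A) * ennreal (\<bar>avg A u - u x\<bar> powr p) \<partial>lebesgue_on B)"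
    by (rule nn_integral_cmult[symmetric]) measurable
  also have "\<dots> \<le> (\<integral>\<^sup>+x. ennreal (r powr s) * ?h x \<partial>lebesgue_on B)"
  proof (rule nn_integral_mono)
    fix x assume "x \<in> space (lebesgue_on B)"
    then have x: "x \<in> B" by simp
    show "ennreal (measure lebesgue A) * ennreal (\<bar>avg A u - u x\<bar> powr p) \<le> ennreal (r powr s) * ?h x"
      using powr_diff_avg_le_energy[OF p s u A r[OF _ x]]
      by (simp add: abs_minus_commute flip: ennreal_mult)
  qed
  also have "\<dots> \<le> (\<integral>\<^sup>+x. ennreal (r powr s) * ?h x \<partial>lebesgue_on D)"
    by (rule nn_integral_lebesgue_on_mono_set[OF B(2) Bs D_sets])
  also have "\<dots> = ennreal (r powr s) * (\<integral>\<^sup>+x. ?h x \<partial>lebesgue_on D)"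
    by (intro nn_integral_cmult measurable_inner_energy) measurable
  finally show ?thesis .
qed

end

lemma powr_le_imp_le_root:
  fixes X M Y p :: real
  assumes "0 < p" "0 \<le> X" "0 \<le> M" "0 \<le> Y" "X powr p \<le> M * Y"
  shows "X \<le> M powr (1 / p) * Y powr (1 / p)"
proof -
  have "X = (X powr p) powr (1 / p)" using assms by (simp add: powr_powr)
  also have "\<dots> \<le> (M * Y) powr (1 / p)" using assms by (intro powr_mono2) auto
  finally show ?thesis using assms by (simp add: powr_mult)
qed

text \<open>
  The core of Hedberg's argument, free of measure theory.  The scale $2^{-k}$ approximates $v$ by
  $a_k$ with an error that decreases geometrically in $k$, while passing from $a_k$ to $a_0$ costs a
  geometric series that is dominated by its last term.  Balancing the errors $2^{-\alpha k} H$ and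
  $2^{\beta k} \Phi$ by taking $2^{(\alpha+\beta) k}$ comparable to $H/\Phi$ gives
  $H^\theta \Phi^{1-\theta}$.  If $H \le \Phi$ this choice would ask for $k \le 0$; then $k = 0$ gives a
  multiple of $\Phi$.
\<close>

lemma geometric_interpolation:
  fixes a :: "nat \<Rightarrow> real" and v K H \<Phi> \<alpha> \<beta> :: real
  assumes \<alpha>: "0 < \<alpha>" and \<beta>: "0 < \<beta>" and K: "0 \<le> K" and H: "0 \<le> H" and \<Phi>: "0 \<le> \<Phi>"
    and zero: "\<Phi> = 0 \<Longrightarrow> H = 0"
    and fine: "\<And>k. \<bar>v - a k\<bar> \<le> K * 2 powr (- (\<alpha> * k)) * H"
    and step: "\<And>k. \<bar>a k - a (Suc k)\<bar> \<le> K * 2 powr (\<beta> * k) * \<Phi>"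
  defines "\<theta> \<equiv> \<beta> / (\<alpha> + \<beta>)"
  shows "\<bar>v - a 0\<bar> \<le> K * (2 powr \<alpha> + 1 / (2 powr \<beta> - 1)) * (H powr \<theta> * \<Phi> powr (1 - \<theta>) + \<Phi>)"
proof -
  define L where "L = 1 / (2 powr \<beta> - 1)"
  have lam: "1 < 2 powr \<beta>" using powr_less_mono[of 0 \<beta> 2] \<beta> by simp
  then have L: "0 < L" by (simp add: L_def)
  have L1: "L + 1 = 2 powr \<beta> * L"
  proof -
    have "2 powr \<beta> - 1 \<noteq> 0" using lam by linarith
    then show ?thesis unfolding L_def by (simp add: divide_simps)
  qed
  have tele: "\<bar>a k - a 0\<bar> \<le> K * L * 2 powr (\<beta> * k) * \<Phi>" for k
  proof (induction k)
    case (Suc k)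
    have "\<bar>a (Suc k) - a 0\<bar> \<le> K * L * 2 powr (\<beta> * k) * \<Phi> + K * 2 powr (\<beta> * k) * \<Phi>"
      using Suc.IH step[of k] by linarith
    also have "\<dots> = K * (L + 1) * 2 powr (\<beta> * k) * \<Phi>" by (simp add: algebra_simps)
    also have "\<dots> = K * (2 powr \<beta> * L) * 2 powr (\<beta> * k) * \<Phi>" by (simp only: L1)
    also have "\<dots> = K * L * 2 powr (\<beta> * Suc k) * \<Phi>"
      by (simp add: powr_add algebra_simps)
    finally show ?case .
  qed (use K L \<Phi> in simp)
  have a1: "1 \<le> 2 powr \<alpha>" using \<alpha> by (simp add: ge_one_powr_ge_zero)
  show ?thesis
  proof (cases "H \<le> \<Phi>")
    case True
    have "\<bar>v - a 0\<bar> \<le> K * H" using fine[of 0] by simp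
    also have "\<dots> \<le> K * (2 powr \<alpha> + L) * \<Phi>"
      unfolding mult.assoc
      using True K a1 L H mult_mono[of 1 "2 powr \<alpha> + L" H \<Phi>] by (intro mult_left_mono) auto
    also have "\<dots> \<le> K * (2 powr \<alpha> + L) * (H powr \<theta> * \<Phi> powr (1 - \<theta>) + \<Phi>)"
      using K a1 L by (intro mult_left_mono) auto
    finally show ?thesis by (simp add: L_def)
  next
    case False
    with zero \<Phi> have P: "0 < \<Phi>" and H': "0 < H" "\<Phi> < H" by (cases "\<Phi> = 0", auto)+
    define t where "t = H / \<Phi>"
    have t: "1 < t" using P H' by (simp add: t_def)
    \<comment> \<open>The real solution of the balance equation; rounding it down to k costs only the factor 2 powr alpha.\<close>
    define w where "w = log 2 t / (\<alpha> + \<beta>)"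
    have w: "0 \<le> w" using t \<alpha> \<beta> by (simp add: w_def)
    define k where "k = nat \<lfloor>w\<rfloor>"
    have k: "real k \<le> w" "w < real k + 1" using w by (auto simp: k_def)
    have "\<beta> * k \<le> \<theta> * log 2 t"
      using mult_left_mono[OF k(1), of \<beta>] \<beta> by (simp add: w_def \<theta>_def)
    then have "2 powr (\<beta> * k) \<le> 2 powr (\<theta> * log 2 t)" by (intro powr_mono) auto
    also have "\<dots> = t powr \<theta>"
      using t by (simp add: mult.commute[of \<theta>] flip: powr_powr)
    finally have up: "2 powr (\<beta> * k) \<le> t powr \<theta>" .
    have "(1 - \<theta>) * log 2 t = \<alpha> * w"
      using \<alpha> \<beta> by (simp add: w_def \<theta>_def field_simps)
    then have "- (\<alpha> * k) \<le> \<alpha> + (\<theta> - 1) * log 2 t"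
      using mult_strict_left_mono[OF k(2) \<alpha>] by (simp add: algebra_simps)
    then have "2 powr (- (\<alpha> * k)) \<le> 2 powr (\<alpha> + (\<theta> - 1) * log 2 t)" by (intro powr_mono) auto
    also have "\<dots> = 2 powr \<alpha> * t powr (\<theta> - 1)"
      using t by (simp add: powr_add mult.commute[of "\<theta> - 1"] flip: powr_powr)
    finally have down: "2 powr (- (\<alpha> * k)) \<le> 2 powr \<alpha> * t powr (\<theta> - 1)" .
    have HP: "t powr (\<theta> - 1) * H = t powr \<theta> * \<Phi>"
      using t P H' by (simp add: powr_diff) (simp add: t_def)
    have "\<bar>v - a 0\<bar> \<le> K * 2 powr (- (\<alpha> * k)) * H + K * L * 2 powr (\<beta> * k) * \<Phi>"
      using fine[of k] tele[of k] by linarith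
    also have "\<dots> \<le> K * (2 powr \<alpha> * t powr (\<theta> - 1)) * H + K * L * (t powr \<theta>) * \<Phi>"
      using up down K L H \<Phi> by (intro add_mono mult_right_mono mult_left_mono) auto
    also have "\<dots> = K * (2 powr \<alpha> * (t powr (\<theta> - 1) * H)) + K * L * (t powr \<theta>) * \<Phi>" by simp
    also have "\<dots> = K * (2 powr \<alpha> + L) * (t powr \<theta> * \<Phi>)"
      unfolding HP by (simp add: algebra_simps)
    also have "t powr \<theta> * \<Phi> = H powr \<theta> * \<Phi> powr (1 - \<theta>)"
      using P H' by (simp add: t_def powr_divide powr_diff)
    also have "K * (2 powr \<alpha> + L) * (H powr \<theta> * \<Phi> powr (1 - \<theta>))
       \<le> K * (2 powr \<alpha> + L) * (H powr \<theta> * \<Phi> powr (1 - \<theta>) + \<Phi>)"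
      using K a1 L \<Phi> by (intro mult_left_mono) auto
    finally show ?thesis by (simp add: L_def)
  qed
qed

context conull_in_convex
begin

text \<open>
  The two hypotheses of the interpolation lemma, for the averages of $u$ over the shrunk copies.  With
  $s = n + \delta p$ the energy bounds carry the factors $r^s / |A|$ and $r^s / (|A| |B|)$, where
  $r$ is comparable to $2^{-k}$ and $|A|$, $|B|$ are comparable to $2^{-kn}$.  This leaves
  $2^{-k \delta p}$ and $2^{k (n - \delta p)}$, and $n - \delta p = n p / q$ by the critical relation
  between the exponents.
\<close>

lemma shrunk_averages_estimates:
  fixes p q \<delta> :: real
  assumes p: "1 < p" and q: "1 < q" and \<delta>: "0 < \<delta>" and pq: "1 / p - 1 / q = \<delta> / real CARD('n)"
  obtains K where "0 \<le> K"
    "\<And>u x k F. integrable (lebesgue_on D) u \<Longrightarrow> x \<in> D \<Longrightarrow> 0 \<le> F \<Longrightarrow>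
      (\<integral>\<^sup>+y. ennreal (\<bar>u x - u y\<bar> powr p / norm (x - y) powr (real CARD('n) + \<delta> * p)) \<partial>lebesgue_on D) = ennreal F \<Longrightarrow>
      \<bar>u x - avg (shrunk x ((1/2) ^ k)) u\<bar> \<le> K * 2 powr (- (\<delta> * real k)) * F powr (1 / p)"
    "\<And>u x k F. integrable (lebesgue_on D) u \<Longrightarrow> x \<in> D \<Longrightarrow> 0 \<le> F \<Longrightarrow>
      frac_energy D (\<lambda>x. D) \<delta> p u = ennreal F \<Longrightarrow>
      \<bar>avg (shrunk x ((1/2) ^ k)) u - avg (shrunk x ((1/2) ^ Suc k)) u\<bar>
        \<le> K * 2 powr (real CARD('n) / q * real k) * F powr (1 / p)"
proof -
  let ?n = "real CARD('n)"
  define m where "m = measure lebesgue D"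
  have m: "0 < m" using D_pos by (simp add: m_def)
  \<comment> \<open>Twice the diameter bounds distances between points of two shrunk copies, through their common centre x.\<close>
  define d where "d = 2 * diameter G"
  have d: "0 \<le> d" using diameter_ge_0[OF bounded_G] by (simp add: d_def)
  define s where "s = ?n + \<delta> * p"
  have s: "0 < s" using \<delta> p by (simp add: s_def add_pos_pos)
  define M1 where "M1 = d powr s / m"
  define M2 where "M2 = d powr s * 2 ^ CARD('n) / m\<^sup>2"
  have M: "0 \<le> M1" "0 \<le> M2" using m by (auto simp: M1_def M2_def)
  define K where "K = M1 powr (1 / p) + M2 powr (1 / p)"
  have half: "0 < (1 / 2 :: real) ^ k" "(1 / 2 :: real) ^ k \<le> 1" for k
    by (auto simp: power_le_one)
  have half_powr: "(1 / 2 :: real) ^ k = 2 powr (- real k)" for k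
    by (simp add: powr_minus powr_realpow power_divide field_simps)
  note sm = shrunk_lmeasurable[OF subsetD[OF D_subset] half] 
  have mk: "measure lebesgue (shrunk x ((1/2) ^ k)) = 2 powr (- (?n * k)) * m" if "x \<in> D" for x k
    using measure_shrunk[OF subsetD[OF D_subset that] half[of k]]
    by (simp add: m_def half_powr powr_realpow[symmetric] powr_powr mult.commute)
  have dist_k: "norm (x - y) \<le> (1/2) ^ k * diameter G" if "x \<in> D" "y \<in> shrunk x ((1/2) ^ k)" for x y k
    using norm_shrunk_le[OF subsetD[OF D_subset that(1)] half(1) that(2)] .
  have rk: "((1/2) ^ k * d) powr s = 2 powr (- (s * k)) * d powr s" for k
    using d by (simp add: half_powr powr_mult powr_powr mult.commute)
  have fine: "\<bar>u x - avg (shrunk x ((1/2) ^ k)) u\<bar> \<le> K * 2 powr (- (\<delta> * real k)) * F powr (1 / p)"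
    if u: "integrable (lebesgue_on D) u" and x: "x \<in> D" and F: "0 \<le> F"
      "(\<integral>\<^sup>+y. ennreal (\<bar>u x - u y\<bar> powr p / norm (x - y) powr (?n + \<delta> * p)) \<partial>lebesgue_on D) = ennreal F"
    for u x k F
  proof -
    let ?A = "shrunk x ((1/2) ^ k)"
    define X where "X = \<bar>u x - avg ?A u\<bar>"
    have "ennreal (2 powr (- (?n * k)) * m * X powr p) \<le> ennreal (((1/2) ^ k * d) powr s) * ennreal F"
      unfolding F(2)[symmetric] mk[OF x, symmetric] s_def[symmetric] X_def
    proof (rule powr_diff_avg_le_energy[OF p s u sm[OF x] shrunk_subset])
      show "0 < measure lebesgue ?A" using m by (simp add: mk[OF x])
      fix y assume "y \<in> ?A"
      from dist_k[OF x this] have "norm (x - y) \<le> (1/2) ^ k * diameter G" .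
      also have "\<dots> \<le> (1/2) ^ k * d"
        using diameter_ge_0[OF bounded_G] by (intro mult_left_mono) (auto simp: d_def)
      finally show "norm (x - y) \<le> (1/2) ^ k * d" .
    qed
    then have "2 powr (- (?n * k)) * m * X powr p \<le> 2 powr (- (s * k)) * d powr s * F"
      using F(1) by (simp add: rk flip: ennreal_mult)
    then have "2 powr (?n * k) / m * (2 powr (- (?n * k)) * m * X powr p)
        \<le> 2 powr (?n * k) / m * (2 powr (- (s * k)) * d powr s * F)"
      using m by (intro mult_left_mono) auto
    also have "2 powr (?n * k) / m * (2 powr (- (?n * k)) * m * X powr p) = X powr p"
      using m by (simp add: powr_minus field_simps)
    also have "2 powr (?n * k) / m * (2 powr (- (s * k)) * d powr s * F) = M1 * (2 powr (?n * k + - (s * k)) * F)"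
      unfolding powr_add M1_def by simp
    also have "?n * k + - (s * k) = - (\<delta> * k) * p"
      by (simp add: s_def algebra_simps)
    finally have "X \<le> M1 powr (1 / p) * (2 powr (- (\<delta> * k) * p) * F) powr (1 / p)"
      using p M F by (intro powr_le_imp_le_root) (auto simp: X_def)
    also have "\<dots> = M1 powr (1 / p) * 2 powr (- (\<delta> * k)) * F powr (1 / p)"
      using p F by (simp add: powr_mult powr_powr)
    also have "\<dots> \<le> K * 2 powr (- (\<delta> * k)) * F powr (1 / p)"
      by (intro mult_right_mono) (auto simp: K_def)
    finally show ?thesis by (simp add: X_def)
  qed
  have step: "\<bar>avg (shrunk x ((1/2) ^ k)) u - avg (shrunk x ((1/2) ^ Suc k)) u\<bar>
        \<le> K * 2 powr (?n / q * real k) * F powr (1 / p)"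
    if u: "integrable (lebesgue_on D) u" and x: "x \<in> D" and F: "0 \<le> F"
      "frac_energy D (\<lambda>x. D) \<delta> p u = ennreal F"
    for u x k F
  proof -
    let ?A = "shrunk x ((1/2) ^ k)" and ?B = "shrunk x ((1/2) ^ Suc k)"
    define X where "X = \<bar>avg ?A u - avg ?B u\<bar>"
    have "ennreal (2 powr (- (?n * k)) * m * (2 powr (- (?n * Suc k)) * m) * X powr p)
        \<le> ennreal (((1/2) ^ k * d) powr s) * ennreal F"
      unfolding F(2)[symmetric] mk[OF x, symmetric] s_def[symmetric] X_def frac_energy_def
    proof (rule powr_diff_avgs_le_energy[OF p s u sm[OF x] shrunk_subset _ sm[OF x] shrunk_subset])
      show "0 < measure lebesgue ?A" "0 < measure lebesgue ?B" using m by (simp_all only: mk[OF x]) simp_all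
      fix z y assume "y \<in> ?A" "z \<in> ?B"
      then have y: "norm (x - y) \<le> (1/2) ^ k * diameter G"
        and z: "norm (x - z) \<le> (1/2) ^ Suc k * diameter G"
        using dist_k[OF x] by blast+
      have "(1/2) ^ Suc k * diameter G \<le> (1/2) ^ k * diameter G"
        using diameter_ge_0[OF bounded_G] by (intro mult_right_mono power_decreasing) auto
      with z have "norm (x - z) \<le> (1/2) ^ k * diameter G" by (rule order_trans)
      with y have "norm (x - y) + norm (x - z) \<le> (1/2) ^ k * d" by (simp add: d_def)
      moreover have "norm (z - y) \<le> norm (x - y) + norm (x - z)"
        using norm_triangle_ineq4[of "x - y" "x - z"] by simp
      ultimately show "norm (z - y) \<le> (1/2) ^ k * d" by simp
    qed
    then have "2 powr (- (?n * k)) * m * (2 powr (- (?n * Suc k)) * m) * X powr p \<le> 2 powr (- (s * k)) * d powr s * F"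
      using F(1) by (simp add: rk flip: ennreal_mult)
    then have "2 powr (?n * k) * 2 powr (?n * Suc k) / m\<^sup>2 * (2 powr (- (?n * k)) * m * (2 powr (- (?n * Suc k)) * m) * X powr p)
        \<le> 2 powr (?n * k) * 2 powr (?n * Suc k) / m\<^sup>2 * (2 powr (- (s * k)) * d powr s * F)"
      using m by (intro mult_left_mono) auto
    also have "2 powr (?n * k) * 2 powr (?n * Suc k) / m\<^sup>2 * (2 powr (- (?n * k)) * m * (2 powr (- (?n * Suc k)) * m) * X powr p)
        = (2 powr (?n * k) * 2 powr (- (?n * k))) * (2 powr (?n * Suc k) * 2 powr (- (?n * Suc k))) * X powr p"
      using m by (simp only: power2_eq_square) (simp only: field_simps, simp)
    also have "\<dots> = X powr p"
      by (simp only: powr_add[symmetric]) simp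
    also have "2 powr (?n * k) * 2 powr (?n * Suc k) / m\<^sup>2 * (2 powr (- (s * k)) * d powr s * F)
        = M2 * (2 powr (?n * k + ?n * k + - (s * k)) * F)"
      unfolding powr_add M2_def
      by (simp add: algebra_simps powr_add powr_realpow)
    also have "?n * k + ?n * k + - (s * k) = ?n / q * k * p"
    proof -
      have "?n - \<delta> * p = ?n / q * p"
        using pq p q by (simp add: field_simps)
      then have "(?n - \<delta> * p) * k = ?n / q * p * k" by simp
      then show ?thesis by (simp add: s_def algebra_simps)
    qed
    finally have "X \<le> M2 powr (1 / p) * (2 powr (?n / q * k * p) * F) powr (1 / p)"
      using p M F by (intro powr_le_imp_le_root) (auto simp: X_def)
    also have "\<dots> = M2 powr (1 / p) * 2 powr (?n / q * k) * F powr (1 / p)"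
      using p F by (simp add: powr_mult powr_powr)
    also have "\<dots> \<le> K * 2 powr (?n / q * k) * F powr (1 / p)"
      by (intro mult_right_mono) (auto simp: K_def)
    finally show ?thesis by (simp add: X_def)
  qed
  show ?thesis by (rule that[OF _ fine step]) (auto simp: K_def)
qed

text \<open>
  Here $\alpha = \delta$ and $\beta = n/q$, so that $\theta = p/q$ by the relation between the exponents.
  Let $h(x)$ be the inner integral of the energy and $E$ the energy.  Then
  $H = h(x)^{1/p}$ and $\Phi = E^{1/p}$, and the $q$-th power of the interpolated bound is a multiple of
  $h(x) E^{q/p-1} + E^{q/p}$, whose integral is a multiple of $E^{q/p}$.  The hypothesis that $\Phi = 0$
  forces $H = 0$ is satisfied almost everywhere because $h$ integrates to $E$.
\<close>

theorem fractional_sobolev_poincare: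
  fixes p q \<delta> :: real
  assumes p: "1 < p" and q: "1 < q" and \<delta>: "0 < \<delta>" and pq: "1 / p - 1 / q = \<delta> / real CARD('n)"
  shows "\<exists>C > 0. \<forall>u \<in> Lp_on D p.
    (\<integral>\<^sup>+x. ennreal (\<bar>u x - avg D u\<bar> powr q) \<partial>lebesgue_on D)
      \<le> ennreal C * enn_powr (frac_energy D (\<lambda>x. D) \<delta> p u) (q / p)"
proof -
  let ?n = "real CARD('n)"
  define m where "m = measure lebesgue D"
  have m: "0 < m" using D_pos by (simp add: m_def)
  obtain K where K: "0 \<le> K"
    and fine: "\<And>u x k F. integrable (lebesgue_on D) u \<Longrightarrow> x \<in> D \<Longrightarrow> 0 \<le> F \<Longrightarrow>
      (\<integral>\<^sup>+y. ennreal (\<bar>u x - u y\<bar> powr p / norm (x - y) powr (real CARD('n) + \<delta> * p)) \<partial>lebesgue_on D) = ennreal F \<Longrightarrow>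
      \<bar>u x - avg (shrunk x ((1/2) ^ k)) u\<bar> \<le> K * 2 powr (- (\<delta> * real k)) * F powr (1 / p)"
    and step: "\<And>u x k F. integrable (lebesgue_on D) u \<Longrightarrow> x \<in> D \<Longrightarrow> 0 \<le> F \<Longrightarrow>
      frac_energy D (\<lambda>x. D) \<delta> p u = ennreal F \<Longrightarrow>
      \<bar>avg (shrunk x ((1/2) ^ k)) u - avg (shrunk x ((1/2) ^ Suc k)) u\<bar>
        \<le> K * 2 powr (real CARD('n) / q * real k) * F powr (1 / p)"
    by (rule shrunk_averages_estimates[OF p q \<delta> pq]) (rule that; blast)
  have n: "0 < ?n" by simp
  have nq: "0 < ?n / q" using q by simp
  have \<theta>: "?n / q / (\<delta> + ?n / q) = p / q"
  proof -
    have "\<delta> = ?n * (1 / p - 1 / q)" unfolding pq by simp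
    then have "\<delta> + ?n / q = ?n / p" by (simp add: right_diff_distrib)
    then show ?thesis using n by simp
  qed
  define L where "L = K * (2 powr \<delta> + 1 / (2 powr (?n / q) - 1))"
  have "1 < 2 powr (?n / q)" using powr_less_mono[OF nq, of 2] by simp
  then have L: "0 \<le> L" unfolding L_def using K by (intro mult_nonneg_nonneg add_nonneg_nonneg) auto
  define M where "M = (2 * L) powr q"
  have main: "(\<integral>\<^sup>+x. ennreal (\<bar>u x - avg D u\<bar> powr q) \<partial>lebesgue_on D)
      \<le> ennreal (M * (1 + m) + 1) * enn_powr (frac_energy D (\<lambda>x. D) \<delta> p u) (q / p)"
    if "u \<in> Lp_on D p" for u
  proof (cases "frac_energy D (\<lambda>x. D) \<delta> p u = \<infinity>")
    case True
    have "0 < M * (1 + m) + 1" using m by (simp add: M_def add_nonneg_pos)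
    then show ?thesis using True
      by (simp add: enn_powr_def ennreal_mult_top)
  next
    case False
    have u: "integrable (lebesgue_on D) u"
      by (rule Lp_on_imp_integrable[OF D_lmeasurable p that])
    have [measurable]: "u \<in> borel_measurable (lebesgue_on D)" using u by simp
    define h where "h x = (\<integral>\<^sup>+y. ennreal (\<bar>u x - u y\<bar> powr p / norm (x - y) powr (?n + \<delta> * p)) \<partial>lebesgue_on D)" for x
    have h_meas[measurable]: "h \<in> borel_measurable (lebesgue_on D)"
      unfolding h_def by (rule measurable_inner_energy) measurable
    have E: "frac_energy D (\<lambda>x. D) \<delta> p u = (\<integral>\<^sup>+x. h x \<partial>lebesgue_on D)"
      by (simp add: frac_energy_def h_def)
    define F where "F = enn2real (frac_energy D (\<lambda>x. D) \<delta> p u)"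
    have F: "0 \<le> F" "frac_energy D (\<lambda>x. D) \<delta> p u = ennreal F"
      using False by (auto simp: F_def top.not_eq_extremum)
    have fin: "AE x in lebesgue_on D. h x \<noteq> \<infinity>"
      using False by (intro nn_integral_PInf_AE) (auto simp: E)
    have zero: "AE x in lebesgue_on D. F = 0 \<longrightarrow> h x = 0"
    proof (cases "F = 0")
      case True
      then have "(\<integral>\<^sup>+x. h x \<partial>lebesgue_on D) = 0" using F by (simp add: E)
      then show ?thesis by (simp add: nn_integral_0_iff_AE)
    qed simp
    \<comment> \<open>Bundling the powers of the total energy keeps the almost-everywhere estimate affine in h x.\<close>
    define F1 where "F1 = F powr (q / p - 1)"
    define F2 where "F2 = F powr (q / p)"
    have FF: "F * F1 = F2"
      using F by (cases "F = 0") (auto simp: F1_def F2_def powr_diff)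
    have "AE x in lebesgue_on D. ennreal (\<bar>u x - avg D u\<bar> powr q)
        \<le> ennreal M * (ennreal F1 * h x + ennreal F2)"
      using fin zero AE_space
    proof eventually_elim
      case (elim x)
      then have x: "x \<in> D" by simp
      define y where "y = enn2real (h x)"
      have y: "0 \<le> y" "h x = ennreal y" using elim by (auto simp: y_def top.not_eq_extremum)
      define H where "H = y powr (1 / p)"
      define \<Phi> where "\<Phi> = F powr (1 / p)"
      define a where "a k = avg (shrunk x ((1/2) ^ k)) u" for k
      have a0: "a 0 = avg D u" by (simp add: a_def shrunk_one)
      have "\<bar>u x - a 0\<bar> \<le> L * (H powr (p / q) * \<Phi> powr (1 - p / q) + \<Phi>)"
        unfolding L_def \<theta>[symmetric]
      proof (rule geometric_interpolation[OF \<delta> nq K])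
        show "0 \<le> H" "0 \<le> \<Phi>" by (auto simp: H_def \<Phi>_def)
        show "\<Phi> = 0 \<Longrightarrow> H = 0" using elim(2) by (simp add: H_def \<Phi>_def y_def)
        show "\<bar>u x - a k\<bar> \<le> K * 2 powr (- (\<delta> * real k)) * H" for k
          unfolding a_def H_def using y by (intro fine[OF u x]) (auto simp: h_def)
        show "\<bar>a k - a (Suc k)\<bar> \<le> K * 2 powr (?n / q * real k) * \<Phi>" for k
          unfolding a_def \<Phi>_def by (intro step[OF u x F])
      qed
      also have "\<dots> \<le> L * (2 * max (H powr (p / q) * \<Phi> powr (1 - p / q)) \<Phi>)"
        using L by (intro mult_left_mono) auto
      finally have "\<bar>u x - a 0\<bar> powr q \<le> (2 * L * max (H powr (p / q) * \<Phi> powr (1 - p / q)) \<Phi>) powr q"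
        using q by (intro powr_mono2) (auto simp: mult_ac)
      also have "\<dots> = M * max (H powr (p / q) * \<Phi> powr (1 - p / q)) \<Phi> powr q"
        using L by (simp add: powr_mult M_def \<Phi>_def)
      also have "\<dots> \<le> M * ((H powr (p / q) * \<Phi> powr (1 - p / q)) powr q + \<Phi> powr q)"
        by (intro mult_left_mono) (auto simp: max_def M_def)
      also have "(H powr (p / q) * \<Phi> powr (1 - p / q)) powr q = y * F powr ((1 - p / q) * q / p)"
        using p q y F by (simp add: H_def \<Phi>_def powr_mult powr_powr)
      also have "(1 - p / q) * q / p = q / p - 1" using p q by (simp add: field_simps)
      also have "\<Phi> powr q = F2" by (simp add: \<Phi>_def F2_def powr_powr)
      finally have "\<bar>u x - a 0\<bar> powr q \<le> M * (F1 * y + F2)"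
        by (simp add: F1_def mult.commute)
      then show ?case using y
        by (simp add: a0 M_def F1_def F2_def ennreal_leI flip: ennreal_mult ennreal_plus)
    qed
    then have "(\<integral>\<^sup>+x. ennreal (\<bar>u x - avg D u\<bar> powr q) \<partial>lebesgue_on D)
        \<le> (\<integral>\<^sup>+x. ennreal M * (ennreal F1 * h x + ennreal F2) \<partial>lebesgue_on D)"
      by (rule nn_integral_mono_AE)
    also have "\<dots> = ennreal M * (ennreal F1 * ennreal F + ennreal F2 * ennreal m)"
      using F D_lmeasurable
      by (simp add: nn_integral_cmult nn_integral_add E emeasure_restrict_space emeasure_eq_measure2 m_def)
    also have "\<dots> = ennreal (M * (1 + m) * F2)"
      using F m FF by (simp add: M_def F1_def F2_def algebra_simps flip: ennreal_mult ennreal_plus)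
    also have "\<dots> \<le> ennreal ((M * (1 + m) + 1) * F2)"
      by (intro ennreal_leI mult_right_mono) (auto simp: F2_def)
    also have "\<dots> = ennreal (M * (1 + m) + 1) * enn_powr (frac_energy D (\<lambda>x. D) \<delta> p u) (q / p)"
    proof -
      have "enn_powr (frac_energy D (\<lambda>x. D) \<delta> p u) (q / p) = ennreal F2"
        using F by (simp add: enn_powr_def F2_def)
      then show ?thesis using m by (simp only: ennreal_mult M_def F2_def powr_ge_zero add_nonneg_nonneg
        mult_nonneg_nonneg less_imp_le zero_le_one)
    qed
    finally show ?thesis .
  qed
  have "0 < M * (1 + m) + 1" using m by (simp add: M_def add_nonneg_pos)
  with main show ?thesis by blast
qed

end

section \<open>The Riesz kernel on a ball\<close>

text \<open>
  On the dyadic shell between the radii $\rho 2^{-k-1}$ and $\rho 2^{-k}$ the kernel is at most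
  $(\rho 2^{-k})^\beta (\rho 2^{-k-1})^{-n}$, whatever the sign of $\beta - n$.  Multiplied by the
  measure of the surrounding ball this is $2^n |B(0,1)| \rho^\beta 2^{-k\beta}$, a geometric series.
\<close>

lemma nn_integral_riesz_kernel_ball:
  fixes x :: "real ^ 'n"
  assumes \<beta>: "0 < \<beta>" and \<rho>: "0 < \<rho>"
  shows "(\<integral>\<^sup>+y. ennreal (norm (x - y) powr (\<beta> - real CARD('n))) * indicator (ball x \<rho>) y \<partial>lebesgue)
    \<le> ennreal (2 ^ CARD('n) * measure lebesgue (ball (0 :: real ^ 'n) 1) / (1 - 2 powr (- \<beta>)) * \<rho> powr \<beta>)"
proof -
  let ?n = "real CARD('n)" and ?c = "measure lebesgue (ball (0 :: real ^ 'n) 1)"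
  define r where "r k = \<rho> * (1 / 2) ^ k" for k :: nat
  have r0: "0 < r k" for k using \<rho> by (simp add: r_def)
  define w where "w k = r k powr \<beta> * r (Suc k) powr (- ?n)" for k
  have le: "ennreal (norm (x - y) powr (\<beta> - ?n)) * indicator (ball x \<rho>) y
      \<le> (\<Sum>k. ennreal (w k) * indicator (ball x (r k)) y)" for y
  proof (cases "y \<in> ball x \<rho> \<and> x \<noteq> y")
    case True
    define z where "z = norm (x - y)"
    have z: "0 < z" "z < \<rho>" using True by (auto simp: z_def dist_norm)
    have ex: "\<exists>k. r (Suc k) \<le> z"
    proof -
      obtain k where "(1 / 2) ^ k < z / \<rho>"
        using real_arch_pow_inv[of "z / \<rho>" "1 / 2"] z \<rho> by auto
      then have "r k \<le> z" using \<rho> by (simp add: r_def field_simps)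
      then have "r (Suc k) \<le> z" using r0[of k] by (simp add: r_def)
      then show ?thesis by blast
    qed
    define k where "k = (LEAST k. r (Suc k) \<le> z)"
    have k1: "r (Suc k) \<le> z" unfolding k_def by (rule LeastI_ex[OF ex])
    have k2: "z < r k"
    proof (cases k)
      case 0 then show ?thesis using z by (simp add: r_def)
    next
      case (Suc k')
      then show ?thesis using not_less_Least[of k' "\<lambda>k. r (Suc k) \<le> z"] by (simp add: k_def)
    qed
    have "z powr (\<beta> - ?n) = z powr \<beta> * z powr (- ?n)" by (simp flip: powr_add)
    also have "\<dots> \<le> w k"
      unfolding w_def using k1 k2 z \<beta> r0[of "Suc k"]
      by (intro mult_mono powr_mono2 powr_mono2') auto
    finally have "ennreal (norm (x - y) powr (\<beta> - ?n)) * indicator (ball x \<rho>) y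
        \<le> ennreal (w k) * indicator (ball x (r k)) y"
      using True k2 by (simp add: z_def dist_norm ennreal_leI)
    also have "\<dots> \<le> (\<Sum>k. ennreal (w k) * indicator (ball x (r k)) y)"
    proof -
      define g where "g k = ennreal (w k) * indicator (ball x (r k)) y" for k
      have "sum g {k} \<le> suminf g" by (rule sum_le_suminf) auto
      then have "g k \<le> suminf g" by simp
      then show ?thesis unfolding g_def .
    qed
    finally show ?thesis .
  qed auto
  have [simp]: "emeasure lebesgue (ball x (r k)) = ennreal (r k ^ CARD('n) * ?c)" for k
    using content_ball_conv_unit_ball[of "r k" x] r0[of k] emeasure_lborel_ball_finite[of x "r k"]
    by (simp add: emeasure_eq_ennreal_measure top.not_eq_extremum)
  have wk: "w k * (r k ^ CARD('n) * ?c) = 2 ^ CARD('n) * ?c * \<rho> powr \<beta> * (2 powr (- \<beta>)) ^ k" for k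
  proof -
    have "r k = 2 * r (Suc k)" by (simp add: r_def)
    then have "r k ^ CARD('n) = 2 ^ CARD('n) * r (Suc k) powr ?n"
      using r0[of "Suc k"] by (simp add: powr_realpow power_mult_distrib)
    moreover have "r (Suc k) powr (- ?n) * r (Suc k) powr ?n = 1"
      using r0[of "Suc k"] by (simp flip: powr_add)
    ultimately have "w k * (r k ^ CARD('n) * ?c) = 2 ^ CARD('n) * ?c * r k powr \<beta>"
      by (simp add: w_def)
    also have "r k powr \<beta> = \<rho> powr \<beta> * (2 powr (- \<beta>)) ^ k"
    proof -
      have "(1 / 2 :: real) ^ k = 2 powr (- real k)"
        by (simp add: powr_minus powr_realpow power_one_over inverse_eq_divide)
      moreover have "(2 powr (- \<beta>)) ^ k = (2 powr (- \<beta>)) powr real k" by (simp add: powr_realpow)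
      ultimately have "((1 / 2 :: real) ^ k) powr \<beta> = (2 powr (- \<beta>)) ^ k"
        by (simp add: powr_powr mult.commute)
      then show ?thesis using \<rho> by (simp add: r_def powr_mult)
    qed
    finally show ?thesis by simp
  qed
  have q: "0 < 2 powr (- \<beta>)" "2 powr (- \<beta>) < 1"
    using \<beta> powr_less_mono[of "- \<beta>" 0 2] by auto
  have "(\<integral>\<^sup>+y. ennreal (norm (x - y) powr (\<beta> - ?n)) * indicator (ball x \<rho>) y \<partial>lebesgue)
      \<le> (\<integral>\<^sup>+y. (\<Sum>k. ennreal (w k) * indicator (ball x (r k)) y) \<partial>lebesgue)"
    by (intro nn_integral_mono le)
  also have "\<dots> = (\<Sum>k. \<integral>\<^sup>+y. ennreal (w k) * indicator (ball x (r k)) y \<partial>lebesgue)"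
    by (rule nn_integral_suminf)
      (auto intro!: borel_measurable_times_ennreal borel_measurable_indicator)
  also have "\<dots> = (\<Sum>k. ennreal (2 ^ CARD('n) * ?c * \<rho> powr \<beta> * (2 powr (- \<beta>)) ^ k))"
  proof -
    have "(\<integral>\<^sup>+y. ennreal (w k) * indicator (ball x (r k)) y \<partial>lebesgue) = ennreal (w k * (r k ^ CARD('n) * ?c))" for k
      by (subst nn_integral_cmult_indicator) (auto simp: w_def ennreal_mult')
    then show ?thesis by (simp only: wk)
  qed
  also have "\<dots> = ennreal (\<Sum>k. 2 ^ CARD('n) * ?c * \<rho> powr \<beta> * (2 powr (- \<beta>)) ^ k)"
    using q by (intro suminf_ennreal2) (auto intro!: summable_mult summable_geometric)
  also have "(\<Sum>k. 2 ^ CARD('n) * ?c * \<rho> powr \<beta> * (2 powr (- \<beta>)) ^ k)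
      = 2 ^ CARD('n) * ?c * \<rho> powr \<beta> * (1 / (1 - 2 powr (- \<beta>)))"
    using q by (subst suminf_mult) (auto simp: suminf_geometric intro!: summable_geometric)
  finally show ?thesis by (simp add: field_simps)
qed

section \<open>A cylinder with perforated walls\<close>

definition cross_part :: "'n \<Rightarrow> real ^ 'n \<Rightarrow> real ^ 'n" where
  "cross_part i x = x - (x $ i) *\<^sub>R axis i 1"

definition cylinder :: "'n \<Rightarrow> (real ^ 'n) set" where
  "cylinder i = {x. 0 < x $ i \<and> x $ i < 1 \<and> norm (cross_part i x) < 1}"

definition height :: "nat \<Rightarrow> real" where
  "height j = (1 / 2) ^ Suc j"

text \<open>
  At each of the heights $1/2, 1/4, 1/8, \dots$ the cylinder is cut by a wall which is open only
  in a disc of radius $\epsilon_j$ about the axis.  The walls have measure zero and accumulate only at the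
  bottom of the cylinder, which does not belong to it.
\<close>

definition walled_cylinder :: "'n \<Rightarrow> (nat \<Rightarrow> real) \<Rightarrow> (real ^ 'n) set" where
  "walled_cylinder i \<epsilon> = {x \<in> cylinder i. \<forall>j. x $ i = height j \<longrightarrow> norm (cross_part i x) < \<epsilon> j}"

lemma height_pos: "0 < height j"
  by (simp add: height_def)

lemma height_antimono: "j \<le> k \<Longrightarrow> height k \<le> height j"
  by (simp add: height_def power_decreasing)

lemma linear_cross_part: "linear (cross_part i)"
  by (rule linearI) (auto simp: cross_part_def algebra_simps)

lemma continuous_on_cross_part [continuous_intros]:
  "continuous_on S f \<Longrightarrow> continuous_on S (\<lambda>x. cross_part i (f x))"
  unfolding cross_part_def by (intro continuous_intros)

lemma cross_part_axis [simp]: "cross_part i (s *\<^sub>R axis i 1) = 0"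
  by (simp add: cross_part_def)

lemma open_cylinder: "open (cylinder i)"
  unfolding cylinder_def
  by (intro open_Collect_conj open_Collect_less continuous_intros)

lemma convex_cylinder: "convex (cylinder i)"
proof -
  have "cylinder i = (\<lambda>x. x $ i) -` {0<..<1} \<inter> cross_part i -` ball 0 1"
    by (auto simp: cylinder_def)
  moreover have "linear (\<lambda>x :: real ^ 'a. x $ i)" by (rule linearI) auto
  ultimately show ?thesis
    by (simp add: convex_Int convex_linear_vimage linear_cross_part)
qed

lemma bounded_cylinder: "bounded (cylinder i)"
  unfolding bounded_iff
proof (intro exI ballI)
  fix x assume "x \<in> cylinder i"
  then have "\<bar>x $ i\<bar> \<le> 1" "norm (cross_part i x) \<le> 1" by (auto simp: cylinder_def)
  moreover have "norm x \<le> norm (cross_part i x) + norm ((x $ i) *\<^sub>R (axis i 1 :: real ^ 'a))"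
    using norm_triangle_ineq[of "cross_part i x" "(x $ i) *\<^sub>R axis i 1"] by (simp add: cross_part_def)
  ultimately show "norm x \<le> 2" by simp
qed

text \<open>
  Above any positive height there are only finitely many walls, so locally the set is a finite
  intersection of open conditions.
\<close>

lemma open_walled_cylinder: "open (walled_cylinder i \<epsilon>)"
proof (subst open_subopen, intro ballI)
  fix x assume x: "x \<in> walled_cylinder i \<epsilon>"
  then have "0 < x $ i" by (simp add: walled_cylinder_def cylinder_def)
  then obtain m where "(1 / 2) ^ m < x $ i"
    using real_arch_pow_inv[of "x $ i" "1 / 2"] by auto
  moreover have "height m \<le> (1 / 2) ^ m" unfolding height_def by (intro power_decreasing) auto
  ultimately have m: "height m < x $ i" by linarith
  define U where "U = cylinder i \<inter> {y. height m < y $ i} \<inter>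
    (\<Inter>j\<in>{..<m}. {y. y $ i \<noteq> height j} \<union> {y. norm (cross_part i y) < \<epsilon> j})"
  have "open U"
    unfolding U_def
    by (intro open_Int open_INT open_Un open_cylinder open_Collect_less open_Collect_neq continuous_intros)
       (auto intro!: open_Un open_Collect_less open_Collect_neq continuous_intros)
  moreover have "x \<in> U" using x m by (auto simp: U_def walled_cylinder_def)
  moreover have "U \<subseteq> walled_cylinder i \<epsilon>"
  proof
    fix y assume y: "y \<in> U"
    have "norm (cross_part i y) < \<epsilon> j" if "y $ i = height j" for j
    proof -
      have "j < m" using y that height_antimono[of m j] by (force simp: U_def not_less[symmetric])
      then show ?thesis using y that by (auto simp: U_def)
    qed
    then show "y \<in> walled_cylinder i \<epsilon>" using y by (auto simp: U_def walled_cylinder_def)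
  qed
  ultimately show "\<exists>T. open T \<and> x \<in> T \<and> T \<subseteq> walled_cylinder i \<epsilon>" by blast
qed

lemma axis_in_walled_cylinder:
  assumes "\<And>j. 0 < \<epsilon> j" "0 < s" "s < 1"
  shows "s *\<^sub>R axis i 1 \<in> walled_cylinder i \<epsilon>"
  using assms by (simp add: walled_cylinder_def cylinder_def)

text \<open>
  The axis passes through every aperture, and each horizontal slice is a disc centred on the axis.
  Hence the set is a union of connected sets that contain the axis.
\<close>

lemma connected_walled_cylinder:
  assumes \<epsilon>: "\<And>j. 0 < \<epsilon> j"
  shows "connected (walled_cylinder i \<epsilon>)"
proof -
  let ?D = "walled_cylinder i \<epsilon>"
  define A where "A = (\<lambda>s. s *\<^sub>R (axis i 1 :: real ^ 'a)) ` {0<..<1}"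
  define S where "S x = A \<union> closed_segment x ((x $ i) *\<^sub>R axis i 1)" for x :: "real ^ 'a"
  have A: "A \<subseteq> ?D" using axis_in_walled_cylinder[OF \<epsilon>] by (auto simp: A_def)
  have seg: "closed_segment x ((x $ i) *\<^sub>R axis i 1) \<subseteq> ?D" if x: "x \<in> ?D" for x
  proof
    fix y assume "y \<in> closed_segment x ((x $ i) *\<^sub>R axis i 1)"
    then obtain s where s: "0 \<le> s" "s \<le> 1" "y = (1 - s) *\<^sub>R x + s *\<^sub>R ((x $ i) *\<^sub>R axis i 1)"
      by (auto simp: closed_segment_def)
    have i: "y $ i = x $ i" by (simp add: s algebra_simps)
    have "cross_part i y = (1 - s) *\<^sub>R cross_part i x"
      by (simp add: cross_part_def i) (simp add: s algebra_simps)
    then have "norm (cross_part i y) \<le> norm (cross_part i x)"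
      using s by (simp add: mult_left_le_one_le)
    with x show "y \<in> ?D" by (force simp: walled_cylinder_def cylinder_def i)
  qed
  have "?D = (\<Union>x\<in>?D. S x)"
    using A seg by (auto simp: S_def)
  moreover have "connected (\<Union>x\<in>?D. S x)"
  proof (rule connected_Union)
    have cA: "connected A"
      unfolding A_def by (intro connected_continuous_image continuous_intros) auto
    have "connected (S x)" if "x \<in> ?D" for x
      unfolding S_def
    proof (rule connected_Un[OF cA])
      have "(x $ i) *\<^sub>R axis i 1 \<in> A \<inter> closed_segment x ((x $ i) *\<^sub>R axis i 1)"
        using that by (auto simp: A_def walled_cylinder_def cylinder_def)
      then show "A \<inter> closed_segment x ((x $ i) *\<^sub>R axis i 1) \<noteq> {}" by blast
    qed auto
    then show "\<And>s. s \<in> S ` ?D \<Longrightarrow> connected s" by auto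
    have "(1 / 2) *\<^sub>R axis i 1 \<in> A" by (auto simp: A_def)
    then show "\<Inter> (S ` ?D) \<noteq> {}" by (auto simp: S_def)
  qed
  ultimately show ?thesis by simp
qed

lemma negligible_walls:
  fixes i :: "'n::finite"
  shows "negligible (cylinder i - walled_cylinder i \<epsilon>)"
proof (rule negligible_subset)
  show "negligible (\<Union>j. {x :: real ^ 'n. x $ i = height j})"
    by (intro negligible_countable_Union) (auto simp: cart_eq_inner_axis negligible_standard_hyperplane)
qed (auto simp: walled_cylinder_def)

section \<open>Test functions for single walls\<close>

definition wall_centre :: "'n \<Rightarrow> nat \<Rightarrow> real ^ 'n" where
  "wall_centre i j = height j *\<^sub>R axis i 1"

text \<open>
  Essentially the indicator function of the part below the wall at \<open>height j\<close>.  It is cut off to zero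
  already at distance \<open>R\<close> from the aperture, so that pairs of points which see each other through the
  aperture contribute nothing, and it grows linearly to 1 between the distances \<open>R\<close> and \<open>2 * R\<close>.
\<close>

definition room_function :: "'n \<Rightarrow> nat \<Rightarrow> real \<Rightarrow> real ^ 'n \<Rightarrow> real" where
  "room_function i j R x =
     (if x $ i < height j then max 0 (min 1 (norm (x - wall_centre i j) / R - 1)) else 0)"

text \<open>
  A segment from a point inside to a point outside meets the frontier.
\<close>

lemma infdist_frontier_le:
  fixes D :: "'a :: euclidean_space set"
  assumes "x \<in> D" "z \<notin> D"
  shows "infdist x (frontier D) \<le> dist x z"
proof -
  have "closed_segment x z \<inter> frontier D \<noteq> {}"
    by (rule connected_Int_frontier) (use assms in auto)
  then obtain w where w: "w \<in> closed_segment x z" "w \<in> frontier D" by blast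
  have "infdist x (frontier D) \<le> dist x w" by (rule infdist_le[OF w(2)])
  also have "\<dots> \<le> dist x z"
    using dist_in_closed_segment[OF w(1)] by (simp add: dist_commute)
  finally show ?thesis .
qed

text \<open>
  The rim of the aperture lies on the wall.  It contains a point at distance \<open>\<epsilon> j\<close> from the centre in
  the direction of a second coordinate axis, and this is where two dimensions enter.
\<close>

lemma infdist_frontier_le_aperture:
  assumes "l \<noteq> i" "0 < \<epsilon> j" "x \<in> walled_cylinder i \<epsilon>"
  shows "infdist x (frontier (walled_cylinder i \<epsilon>)) \<le> norm (x - wall_centre i j) + \<epsilon> j"
proof -
  define z where "z = wall_centre i j + \<epsilon> j *\<^sub>R axis l 1"
  have zi: "z $ i = height j" using assms(1) by (simp add: z_def wall_centre_def axis_def)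
  have "cross_part i z = \<epsilon> j *\<^sub>R axis l 1"
    by (simp add: cross_part_def zi) (simp add: z_def wall_centre_def)
  then have "norm (cross_part i z) = \<epsilon> j" using assms by simp
  then have "z \<notin> walled_cylinder i \<epsilon>" using zi by (auto simp: walled_cylinder_def)
  then have "infdist x (frontier (walled_cylinder i \<epsilon>)) \<le> norm (x - z)"
    using infdist_frontier_le[OF assms(3)] by (simp add: dist_norm)
  also have "\<dots> \<le> norm (x - wall_centre i j) + \<epsilon> j"
    using norm_triangle_ineq4[of "x - wall_centre i j" "\<epsilon> j *\<^sub>R axis l 1"] assms
    by (simp add: z_def algebra_simps)
  finally show ?thesis .
qed

text \<open>
  Let $d$ be the distance of $x$ from the frontier.  The segment from $x$ to $y$ meets the height of the
  wall in a point $z$ with $|x - z| < \tau d$.  Hence $z$ belongs to the domain and therefore to the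
  aperture.  The rim of the aperture then forces $d \le \tau d + 2 \epsilon_j$, that is,
  $d \le 2 \epsilon_j / (1 - \tau)$, and both points are close to the centre.
\<close>

lemma crossing_near_aperture:
  fixes x y :: "real ^ 'n"
  assumes l: "l \<noteq> i" and \<tau>: "0 < \<tau>" "\<tau> < 1" and \<epsilon>: "0 < \<epsilon> j"
    and x: "x \<in> walled_cylinder i \<epsilon>"
    and y: "y \<in> ball x (\<tau> * infdist x (frontier (walled_cylinder i \<epsilon>)))"
    and cross: "x $ i \<le> height j \<and> height j \<le> y $ i \<or> y $ i \<le> height j \<and> height j \<le> x $ i"
  shows "norm (x - wall_centre i j) \<le> 3 * \<epsilon> j / (1 - \<tau>)"
    and "norm (y - wall_centre i j) \<le> 3 * \<epsilon> j / (1 - \<tau>)"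
proof -
  let ?D = "walled_cylinder i \<epsilon>" and ?c = "wall_centre i j"
  define d where "d = infdist x (frontier ?D)"
  have xy: "dist x y < \<tau> * d" using y by (simp add: d_def)
  have d0: "0 \<le> d" by (simp add: d_def infdist_nonneg)
  have "\<exists>z\<in>closed_segment x y. z $ i = height j"
    using cross connected_ivt_component_cart[of "closed_segment x y" x y i "height j"]
      connected_ivt_component_cart[of "closed_segment x y" y x i "height j"] by auto
  then obtain z where z: "z \<in> closed_segment x y" "z $ i = height j" by blast
  have zx: "norm (x - z) < \<tau> * d" "norm (y - z) < \<tau> * d"
    using dist_in_closed_segment[OF z(1)] xy by (auto simp: dist_norm norm_minus_commute)
  have "\<tau> * d \<le> d" using \<tau> d0 by (simp add: mult_left_le_one_le)
  then have "z \<in> ?D"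
    using infdist_frontier_le[OF x, of z] zx by (auto simp: d_def dist_norm)
  then have "norm (cross_part i z) < \<epsilon> j" using z by (auto simp: walled_cylinder_def)
  moreover have "z - ?c = cross_part i z" using z by (simp add: cross_part_def wall_centre_def)
  ultimately have zc: "norm (z - ?c) < \<epsilon> j" by simp
  have xc: "norm (x - ?c) < \<tau> * d + \<epsilon> j" "norm (y - ?c) < \<tau> * d + \<epsilon> j"
    using norm_triangle_ineq[of "x - z" "z - ?c"] norm_triangle_ineq[of "y - z" "z - ?c"] zx zc by auto
  have "d \<le> norm (x - ?c) + \<epsilon> j"
    unfolding d_def by (rule infdist_frontier_le_aperture[OF l \<epsilon> x])
  then have "(1 - \<tau>) * d \<le> 2 * \<epsilon> j" using xc by (simp add: algebra_simps)
  then have "d \<le> 2 * \<epsilon> j / (1 - \<tau>)" using \<tau> by (simp add: field_simps)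
  then have "\<tau> * d \<le> 2 * \<epsilon> j / (1 - \<tau>)" using \<open>\<tau> * d \<le> d\<close> by linarith
  moreover have "\<epsilon> j \<le> \<epsilon> j / (1 - \<tau>)" using \<tau> \<epsilon> by (simp add: field_simps)
  moreover have "3 * \<epsilon> j / (1 - \<tau>) = 2 * \<epsilon> j / (1 - \<tau>) + \<epsilon> j / (1 - \<tau>)" by (simp add: add_divide_distrib[symmetric])
  ultimately show "norm (x - ?c) \<le> 3 * \<epsilon> j / (1 - \<tau>)" "norm (y - ?c) \<le> 3 * \<epsilon> j / (1 - \<tau>)"
    using xc by linarith+
qed

text \<open>
  For $y$ within $\tau$ times the distance of $x$ from the frontier, different values at $x$ and $y$ are
  possible only if both points lie below the wall, since the cut-off hides the pairs seen through the
  aperture.  One of them is then within \<open>2 * R\<close> of the centre, which bounds the distance of $x$ from the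
  frontier, and with it $|x-y|$, by a multiple of \<open>R\<close>.
\<close>

lemma room_function_variation:
  fixes x y :: "real ^ 'n"
  assumes l: "l \<noteq> i" and \<tau>: "0 < \<tau>" "\<tau> < 1" and \<epsilon>: "0 < \<epsilon> j"
    and x: "x \<in> walled_cylinder i \<epsilon>"
    and y: "y \<in> ball x (\<tau> * infdist x (frontier (walled_cylinder i \<epsilon>)))"
  defines "R \<equiv> 3 * \<epsilon> j / (1 - \<tau>)"
  assumes ne: "room_function i j R x \<noteq> room_function i j R y"
  shows "\<bar>room_function i j R x - room_function i j R y\<bar> \<le> norm (x - y) / R"
    and "norm (x - y) < 3 * R / (1 - \<tau>)"
    and "norm (x - wall_centre i j) < 2 * R + 3 * R / (1 - \<tau>)"
proof -
  let ?D = "walled_cylinder i \<epsilon>" and ?c = "wall_centre i j" and ?u = "room_function i j R"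
  define d where "d = infdist x (frontier ?D)"
  have d0: "0 \<le> d" by (simp add: d_def infdist_nonneg)
  have R: "0 < R" "\<epsilon> j \<le> R" using \<tau> \<epsilon> by (auto simp: R_def field_simps)
  have zero: "?u z = 0" if "norm (z - ?c) \<le> R \<or> height j \<le> z $ i" for z
    using that R by (auto simp: room_function_def field_simps)
  have both: "x $ i < height j" "y $ i < height j"
    using ne zero crossing_near_aperture[OF l \<tau> \<epsilon> x y] unfolding R_def[symmetric]
    by (metis linorder_le_less_linear less_imp_le)+
  define a where "a z = norm (z - ?c) / R" for z
  have u: "?u x = max 0 (min 1 (a x - 1))" "?u y = max 0 (min 1 (a y - 1))"
    using both by (auto simp: room_function_def a_def)
  have "\<bar>a x - a y\<bar> = \<bar>norm (x - ?c) - norm (y - ?c)\<bar> / R"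
    using R by (simp add: a_def flip: diff_divide_distrib)
  also have "\<dots> \<le> norm (x - y) / R"
    using R norm_triangle_ineq3[of "x - ?c" "y - ?c"] by (intro divide_right_mono) auto
  finally show "\<bar>?u x - ?u y\<bar> \<le> norm (x - y) / R" unfolding u by linarith
  have near: "norm (x - ?c) < 2 * R \<or> norm (y - ?c) < 2 * R"
  proof (rule ccontr)
    assume "\<not> ?thesis"
    then have "2 \<le> a x" "2 \<le> a y" using R by (auto simp: a_def field_simps)
    then show False using ne u by simp
  qed
  have xy: "norm (x - y) < \<tau> * d" using y by (simp add: d_def dist_norm)
  have tri: "norm (x - ?c) \<le> norm (x - y) + norm (y - ?c)"
    using norm_triangle_ineq[of "x - y" "y - ?c"] by simp
  have dle: "d \<le> norm (x - ?c) + \<epsilon> j"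
    unfolding d_def by (rule infdist_frontier_le_aperture[OF l \<epsilon> x])
  have td: "\<tau> * d \<le> d" using \<tau> d0 by (simp add: mult_left_le_one_le)
  have "(1 - \<tau>) * d \<le> 3 * R"
  proof (cases "norm (x - ?c) < 2 * R")
    case True
    then have "d \<le> 3 * R" using dle R by linarith
    moreover have "(1 - \<tau>) * d \<le> d" using \<tau> d0 by (simp add: mult_left_le_one_le)
    ultimately show ?thesis by linarith
  next
    case False
    then have "norm (y - ?c) < 2 * R" using near by simp
    then have "d \<le> \<tau> * d + 3 * R" using dle R tri xy by linarith
    then show ?thesis by (simp add: algebra_simps)
  qed
  then have d: "d \<le> 3 * R / (1 - \<tau>)" using \<tau> by (simp add: field_simps)
  show xy': "norm (x - y) < 3 * R / (1 - \<tau>)" using xy td d by linarith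
  have "0 < 3 * R / (1 - \<tau>)" using R \<tau> by simp
  then show "norm (x - ?c) < 2 * R + 3 * R / (1 - \<tau>)" using near tri xy' by linarith
qed

text \<open>
  By the preceding lemma the integrand is at most $R^{-p} |x-y|^{p - n - \delta p}$ and vanishes unless
  $|x-y|$ and the distance of $x$ from the aperture are at most multiples of $R$.  The Riesz kernel
  of order $\beta = (1-\delta) p$ gives $R^{-p} R^{\beta} R^n = R^{n - \delta p}$.  The order of the
  quantifiers is essential: the constant depends neither on the sizes of the apertures nor on the wall.
\<close>

lemma frac_energy_room_function_le:
  fixes i l :: "'n::finite" and p \<delta> \<tau> :: real
  assumes l: "l \<noteq> i" and \<tau>: "0 < \<tau>" "\<tau> < 1" and \<delta>: "\<delta> < 1" and p: "1 < p"
  shows "\<exists>C > 0. \<forall>\<epsilon> j. 0 < \<epsilon> j \<longrightarrow>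
    frac_energy (walled_cylinder i \<epsilon>)
      (\<lambda>x. ball x (\<tau> * infdist x (frontier (walled_cylinder i \<epsilon>)))) \<delta> p
      (room_function i j (3 * \<epsilon> j / (1 - \<tau>)))
    \<le> ennreal (C * \<epsilon> j powr (real CARD('n) - \<delta> * p))"
proof -
  let ?n = "real CARD('n)"
  define v where "v = measure lebesgue (ball (0 :: real ^ 'n) 1)"
  have v: "0 < v" by (simp add: v_def)
  define \<beta> where "\<beta> = (1 - \<delta>) * p"
  have \<beta>: "0 < \<beta>" using \<delta> p by (simp add: \<beta>_def)
  define B where "B = 2 ^ CARD('n) * v / (1 - 2 powr (- \<beta>))"
  have B: "0 < B" using \<beta> v powr_less_mono[of "- \<beta>" 0 2] by (simp add: B_def)
  define \<kappa> where "\<kappa> = 3 / (1 - \<tau>)"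
  have \<kappa>: "0 < \<kappa>" using \<tau> by (simp add: \<kappa>_def)
  define C where "C = B * \<kappa> powr \<beta> * (2 + \<kappa>) powr ?n * v * \<kappa> powr (?n - \<delta> * p)"
  have C: "0 < C" using B \<kappa> v by (simp add: C_def)
  show ?thesis
  proof (intro exI[of _ C] conjI allI impI C)
    fix \<epsilon> :: "nat \<Rightarrow> real" and j assume \<epsilon>: "0 < \<epsilon> j"
    let ?D = "walled_cylinder i \<epsilon>" and ?c = "wall_centre i j"
    let ?N = "\<lambda>x. ball x (\<tau> * infdist x (frontier ?D))"
    define R where "R = 3 * \<epsilon> j / (1 - \<tau>)"
    have R: "0 < R" "R = \<kappa> * \<epsilon> j" using \<epsilon> \<tau> by (auto simp: R_def \<kappa>_def)
    let ?u = "room_function i j R"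
    define \<rho> where "\<rho> = \<kappa> * R"
    have \<rho>: "0 < \<rho>" using \<kappa> R by (simp add: \<rho>_def)
    define V where "V = R powr (- p) * (B * \<rho> powr \<beta>)"
    have V: "0 \<le> V" using B by (simp add: V_def)
    note var = room_function_variation[of l i \<tau> \<epsilon> j, OF l \<tau> \<epsilon>, folded R_def]
    have inner: "(\<integral>\<^sup>+y. ennreal (\<bar>?u x - ?u y\<bar> powr p / norm (x - y) powr (?n + \<delta> * p)) \<partial>lebesgue_on (?N x))
        \<le> ennreal V * indicator (ball ?c ((2 + \<kappa>) * R)) x" if x: "x \<in> ?D" for x
    proof -
      let ?f = "\<lambda>y. ennreal (\<bar>?u x - ?u y\<bar> powr p / norm (x - y) powr (?n + \<delta> * p))"
      have far: "?u x = ?u y" if y: "y \<in> ?N x" and "x \<notin> ball ?c ((2 + \<kappa>) * R)" for y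
      proof (rule ccontr)
        assume "?u x \<noteq> ?u y"
        from var(3)[OF x y this] that(2) show False
          by (simp add: dist_norm norm_minus_commute \<kappa>_def algebra_simps)
      qed
      have le: "?f y \<le> ennreal (R powr (- p)) * (ennreal (norm (x - y) powr (\<beta> - ?n)) * indicator (ball x \<rho>) y)"
        if y: "y \<in> ?N x" for y
      proof (cases "?u x = ?u y")
        case False
        define z where "z = norm (x - y)"
        have z: "0 < z" using False by (auto simp: z_def)
        have "\<bar>?u x - ?u y\<bar> powr p \<le> (z / R) powr p"
          using var(1)[OF x y False] p by (intro powr_mono2) (auto simp: z_def)
        then have "\<bar>?u x - ?u y\<bar> powr p / z powr (?n + \<delta> * p) \<le> (z / R) powr p / z powr (?n + \<delta> * p)"
          by (intro divide_right_mono) auto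
        also have "\<dots> = R powr (- p) * (z powr p * z powr (- (?n + \<delta> * p)))"
        proof -
          have "(z / R) powr p / z powr s = R powr (- p) * (z powr p * z powr (- s))" for s
          proof -
            have "(z / R) powr p = z powr p / R powr p" using R(1) z by (simp add: powr_divide)
            then show ?thesis by (simp add: powr_minus divide_inverse)
          qed
          then show ?thesis .
        qed
        also have "z powr p * z powr (- (?n + \<delta> * p)) = z powr (\<beta> - ?n)"
          by (simp add: \<beta>_def algebra_simps flip: powr_add)
        finally have "?f y \<le> ennreal (R powr (- p) * z powr (\<beta> - ?n))"
          unfolding z_def by (rule ennreal_leI)
        moreover have "y \<in> ball x \<rho>"
          using var(2)[OF x y False] by (simp add: \<rho>_def \<kappa>_def dist_norm)
        ultimately show ?thesis by (simp add: z_def ennreal_mult)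
      qed (use p in simp)
      show ?thesis
      proof (cases "x \<in> ball ?c ((2 + \<kappa>) * R)")
        case True
        have "(\<integral>\<^sup>+y. ?f y \<partial>lebesgue_on (?N x)) = (\<integral>\<^sup>+y. ?f y * indicator (?N x) y \<partial>lebesgue)"
          by (rule nn_integral_restrict_space) simp
        also have "\<dots> \<le> (\<integral>\<^sup>+y. ennreal (R powr (- p)) * (ennreal (norm (x - y) powr (\<beta> - ?n)) * indicator (ball x \<rho>) y) \<partial>lebesgue)"
          using le by (intro nn_integral_mono) (simp split: split_indicator)
        also have "\<dots> = ennreal (R powr (- p)) * (\<integral>\<^sup>+y. ennreal (norm (x - y) powr (\<beta> - ?n)) * indicator (ball x \<rho>) y \<partial>lebesgue)"
        proof (rule nn_integral_cmult)
          have [measurable]: "(\<lambda>y. y) \<in> lebesgue \<rightarrow>\<^sub>M (borel :: (real ^ 'n) measure)"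
            using id_borel_measurable_lebesgue by (simp add: id_def)
          have "(\<lambda>y. ennreal (norm (x - y) powr (\<beta> - ?n))) \<in> borel_measurable lebesgue" by measurable
          then show "(\<lambda>y. ennreal (norm (x - y) powr (\<beta> - ?n)) * indicator (ball x \<rho>) y) \<in> borel_measurable lebesgue"
            by (intro borel_measurable_times_ennreal borel_measurable_indicator) auto
        qed
        also have "\<dots> \<le> ennreal (R powr (- p)) * ennreal (B * \<rho> powr \<beta>)"
          using nn_integral_riesz_kernel_ball[OF \<beta> \<rho>, of x] by (intro mult_left_mono) (auto simp: B_def v_def)
        also have "\<dots> = ennreal V" using B by (simp add: V_def ennreal_mult)
        finally show ?thesis using True by simp
      next
        case False
        have "(\<integral>\<^sup>+y. ?f y \<partial>lebesgue_on (?N x)) = (\<integral>\<^sup>+y. 0 \<partial>lebesgue_on (?N x))"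
          using far[OF _ False] p by (intro nn_integral_cong) simp
        then show ?thesis by simp
      qed
    qed
    have "frac_energy ?D ?N \<delta> p ?u \<le> (\<integral>\<^sup>+x. ennreal V * indicator (ball ?c ((2 + \<kappa>) * R)) x \<partial>lebesgue_on ?D)"
      unfolding frac_energy_def by (intro nn_integral_mono inner) simp
    also have "\<dots> \<le> (\<integral>\<^sup>+x. ennreal V * indicator (ball ?c ((2 + \<kappa>) * R)) x \<partial>lebesgue)"
      using open_walled_cylinder[of i \<epsilon>]
      by (subst nn_integral_restrict_space) (auto intro!: nn_integral_mono borel_open split: split_indicator)
    also have "\<dots> = ennreal V * ennreal (((2 + \<kappa>) * R) ^ CARD('n) * v)"
      using content_ball_conv_unit_ball[of "(2 + \<kappa>) * R" ?c] R \<kappa> emeasure_lborel_ball_finite[of ?c "(2 + \<kappa>) * R"]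
      by (subst nn_integral_cmult_indicator)
         (auto simp: v_def emeasure_eq_ennreal_measure top.not_eq_extremum)
    also have "\<dots> = ennreal (V * (((2 + \<kappa>) * R) ^ CARD('n) * v))"
      using V R \<kappa> v by (simp add: ennreal_mult)
    also have "V * (((2 + \<kappa>) * R) ^ CARD('n) * v) = C * \<epsilon> j powr (?n - \<delta> * p)"
    proof -
      have 1: "((2 + \<kappa>) * R) ^ CARD('n) = (2 + \<kappa>) powr ?n * R powr ?n"
        using R(1) \<kappa> by (simp add: power_mult_distrib powr_realpow)
      have 2: "\<rho> powr \<beta> = \<kappa> powr \<beta> * R powr \<beta>" using R(1) \<kappa> by (simp add: \<rho>_def powr_mult)
      have 3: "R powr (- p) * R powr \<beta> * R powr ?n = R powr (?n - \<delta> * p)"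
        by (simp add: \<beta>_def algebra_simps flip: powr_add)
      have 4: "R powr (?n - \<delta> * p) = \<kappa> powr (?n - \<delta> * p) * \<epsilon> j powr (?n - \<delta> * p)"
        unfolding R(2) using \<kappa> \<epsilon> by (simp add: powr_mult)
      have "V * (((2 + \<kappa>) * R) ^ CARD('n) * v)
          = B * \<kappa> powr \<beta> * (2 + \<kappa>) powr ?n * v * (R powr (- p) * R powr \<beta> * R powr ?n)"
        unfolding V_def 1 2 by (simp only: mult_ac)
      then show ?thesis unfolding 3 4 C_def by (simp only: mult_ac)
    qed
    finally show "frac_energy ?D ?N \<delta> p (room_function i j (3 * \<epsilon> j / (1 - \<tau>)))
        \<le> ennreal (C * \<epsilon> j powr (?n - \<delta> * p))"
      unfolding R_def .
  qed
qed

lemma room_function_Linf: "room_function i j R \<in> Linf_on D"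
proof -
  have [measurable]: "(\<lambda>x. x) \<in> lebesgue_on D \<rightarrow>\<^sub>M borel"
    using id_borel_measurable_lebesgue_on[of D] by (simp add: id_def)
  have [measurable]: "(\<lambda>x. x $ i) \<in> borel_measurable (lebesgue_on D)"
    by (rule measurable_compose[of "\<lambda>x. x" _ borel]) (auto intro!: borel_measurable_continuous_onI continuous_intros)
  have "room_function i j R \<in> borel_measurable (lebesgue_on D)"
    unfolding room_function_def[abs_def] by measurable
  moreover have "\<bar>room_function i j R x\<bar> \<le> 1" for x by (simp add: room_function_def)
  ultimately show ?thesis by (auto simp: Linf_on_def intro!: exI[of _ 1])
qed

text \<open>
  A lower bound for the amount of space on either side of wall \<open>j\<close> that the transition region does not
  reach.  It is measured in the cylinder without walls, so it is known before the apertures are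
  chosen.
\<close>

definition room_size :: "'n::finite \<Rightarrow> nat \<Rightarrow> real" where
  "room_size i j = min (measure lebesgue (cylinder i \<inter> {x. x $ i < height (Suc j)}))
     (measure lebesgue (cylinder i \<inter> {x. 1 / 2 < x $ i}))"

lemma cylinder_part_pos:
  fixes i :: "'n::finite"
  assumes "open S" "s *\<^sub>R axis i 1 \<in> S" "0 < s" "s < 1"
  shows "0 < measure lebesgue (cylinder i \<inter> S)"
proof -
  have o: "open (cylinder i \<inter> S)" using assms open_cylinder by blast
  have "s *\<^sub>R axis i 1 \<in> cylinder i \<inter> S" using assms by (simp add: cylinder_def)
  then have "\<not> negligible (cylinder i \<inter> S)" using open_not_negligible[OF o] by blast
  moreover have "cylinder i \<inter> S \<in> lmeasurable"
    using o bounded_cylinder by (intro lmeasurable_open) (auto intro: bounded_subset)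
  ultimately show ?thesis
    by (metis antisym_conv2 measure_nonneg negligible_iff_measure)
qed

lemma room_size_pos: "0 < room_size i j"
proof -
  have "open {x :: real ^ 'a. x $ i < height (Suc j)}" "open {x :: real ^ 'a. 1 / 2 < x $ i}"
    by (auto intro!: open_Collect_less continuous_intros)
  moreover have "height (Suc j) < 1" using height_antimono[of 0 "Suc j"] by (simp add: height_def)
  ultimately show ?thesis
    using height_pos[of "Suc j"] cylinder_part_pos[of _ "height (Suc j) / 2" i] cylinder_part_pos[of _ "3 / 4" i]
    by (simp add: room_size_def)
qed

text \<open>
  The walls are null sets, so they do not change the measure.
\<close>

lemma measure_walled_Int:
  fixes i :: "'n::finite"
  assumes "open S"
  shows "measure lebesgue (walled_cylinder i \<epsilon> \<inter> S) = measure lebesgue (cylinder i \<inter> S)"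
proof (rule measure_negligible_symdiff)
  show "cylinder i \<inter> S \<in> lmeasurable"
    using assms open_cylinder bounded_cylinder by (intro lmeasurable_open) (auto intro: bounded_subset)
  show "negligible (cylinder i \<inter> S - walled_cylinder i \<epsilon> \<inter> S \<union> (walled_cylinder i \<epsilon> \<inter> S - cylinder i \<inter> S))"
    by (rule negligible_subset[OF negligible_walls]) (auto simp: walled_cylinder_def)
qed

text \<open>
  The test function is 1 below the next wall and 0 in the upper half of the cylinder.  No number \<open>a\<close> is
  within distance less than $1/2$ of both values.
\<close>

lemma nn_integral_room_function_ge:
  fixes i :: "'n::finite"
  assumes s: "0 < s" and R: "0 < R" "2 * R \<le> height (Suc j)"
  shows "ennreal ((1 / 2) powr s * room_size i j)
    \<le> (\<integral>\<^sup>+x. ennreal (\<bar>room_function i j R x - a\<bar> powr s) \<partial>lebesgue_on (walled_cylinder i \<epsilon>))"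
proof -
  let ?D = "walled_cylinder i \<epsilon>" and ?u = "room_function i j R"
  have D: "?D \<in> sets lebesgue" using open_walled_cylinder[of i \<epsilon>] by auto
  have key: "ennreal ((1 / 2) powr s * room_size i j)
      \<le> (\<integral>\<^sup>+x. ennreal (\<bar>?u x - a\<bar> powr s) \<partial>lebesgue_on ?D)"
    if S: "open S" "room_size i j \<le> measure lebesgue (cylinder i \<inter> S)"
      and ge: "\<And>x. x \<in> S \<Longrightarrow> 1 / 2 \<le> \<bar>?u x - a\<bar>" for S
  proof -
    have S': "?D \<inter> S \<in> lmeasurable"
      using S open_walled_cylinder[of i \<epsilon>] bounded_cylinder[of i]
      by (intro lmeasurable_open) (auto intro: bounded_subset simp: walled_cylinder_def)
    have "ennreal ((1 / 2) powr s * room_size i j) \<le> ennreal ((1 / 2) powr s) * emeasure lebesgue (?D \<inter> S)"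
      using S S' by (simp add: emeasure_eq_measure2 measure_walled_Int ennreal_leI mult_left_mono flip: ennreal_mult)
    also have "\<dots> = (\<integral>\<^sup>+x. ennreal ((1 / 2) powr s) * indicator (?D \<inter> S) x \<partial>lebesgue)"
      using S' by (subst nn_integral_cmult_indicator) (auto simp: fmeasurableD)
    also have "\<dots> \<le> (\<integral>\<^sup>+x. ennreal (\<bar>?u x - a\<bar> powr s) * indicator ?D x \<partial>lebesgue)"
      using ge s by (intro nn_integral_mono) (auto split: split_indicator intro!: ennreal_leI powr_mono2)
    also have "\<dots> = (\<integral>\<^sup>+x. ennreal (\<bar>?u x - a\<bar> powr s) \<partial>lebesgue_on ?D)"
      using D by (simp add: nn_integral_restrict_space)
    finally show ?thesis .
  qed
  show ?thesis
  proof (cases "a \<le> 1 / 2")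
    case True
    show ?thesis
    proof (rule key)
      show "open {x :: real ^ 'n. x $ i < height (Suc j)}" by (intro open_Collect_less continuous_intros)
      show "room_size i j \<le> measure lebesgue (cylinder i \<inter> {x. x $ i < height (Suc j)})" by (simp add: room_size_def)
      fix x :: "real ^ 'n" assume "x \<in> {x. x $ i < height (Suc j)}"
      then have x: "x $ i < height (Suc j)" by simp
      have h: "height j = 2 * height (Suc j)" by (simp add: height_def)
      have "height j - x $ i \<le> \<bar>(x - wall_centre i j) $ i\<bar>" by (simp add: wall_centre_def)
      also have "\<dots> \<le> norm (x - wall_centre i j)" by (rule component_le_norm_cart)
      finally have "2 * R \<le> norm (x - wall_centre i j)" using x h R by linarith
      then have "1 \<le> norm (x - wall_centre i j) / R - 1" using R by (simp add: field_simps)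
      then have "?u x = 1" using x h height_pos[of "Suc j"] by (simp add: room_function_def)
      then show "1 / 2 \<le> \<bar>?u x - a\<bar>" using True by simp
    qed
  next
    case False
    show ?thesis
    proof (rule key)
      show "open {x :: real ^ 'n. 1 / 2 < x $ i}" by (intro open_Collect_less continuous_intros)
      show "room_size i j \<le> measure lebesgue (cylinder i \<inter> {x. 1 / 2 < x $ i})" by (simp add: room_size_def)
      fix x :: "real ^ 'n" assume x: "x \<in> {x. 1 / 2 < x $ i}"
      have "height j \<le> 1 / 2" using height_antimono[of 0 j] by (simp add: height_def)
      then have "?u x = 0" using x by (simp add: room_function_def)
      then show "1 / 2 \<le> \<bar>?u x - a\<bar>" using False by simp
    qed
  qed
qed

section \<open>Failure of the improved inequality\<close>

lemma enn_powr_mono: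
  assumes "x \<le> ennreal b" "0 \<le> b" "0 \<le> a"
  shows "enn_powr x a \<le> ennreal (b powr a)"
proof -
  have "x \<noteq> \<infinity>" using assms by (auto simp: top_unique)
  moreover have "enn2real x \<le> b" using enn2real_mono[OF assms(1)] assms(2) by simp
  ultimately show ?thesis using assms(3)
    by (auto simp: enn_powr_def intro!: ennreal_leI powr_mono2)
qed

text \<open>
  Both inequalities that have to fail are of this form, with $s = 1$ and $s = q$.  For the $j$-th test
  function the left-hand side is at least $2^{-s} m_j$, where $m_j$ is the room size, and the energy to
  the power $s/p$ is at most a constant times $(\epsilon_j^{(n - \delta p)/p})^s$.  The apertures are so
  small that this is at most $m_j / (j+1)$; the minimum with 1 in the hypothesis serves to discard the
  power $s \ge 1$.  Thus $j + 1$ would be bounded.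
\<close>

lemma no_improved_inequality:
  fixes i l :: "'n::finite" and p \<delta> \<tau> s :: real
  assumes l: "l \<noteq> i" and \<tau>: "0 < \<tau>" "\<tau> < 1" and \<delta>: "\<delta> < 1" and p: "1 < p" and s: "1 \<le> s"
    and \<epsilon>: "\<And>j. 0 < \<epsilon> j" "\<And>j. 6 * \<epsilon> j / (1 - \<tau>) \<le> height (Suc j)"
    and small: "\<And>j. \<epsilon> j powr ((real CARD('n) - \<delta> * p) / p) \<le> min 1 (room_size i j) / (real j + 1)"
  shows "\<not> (\<exists>C > 0. \<forall>u \<in> Linf_on (walled_cylinder i \<epsilon>).
       (\<integral>\<^sup>+x. ennreal (\<bar>u x - avg (walled_cylinder i \<epsilon>) u\<bar> powr s) \<partial>lebesgue_on (walled_cylinder i \<epsilon>))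
         \<le> ennreal C * enn_powr (frac_energy (walled_cylinder i \<epsilon>)
              (\<lambda>x. ball x (\<tau> * infdist x (frontier (walled_cylinder i \<epsilon>)))) \<delta> p u) (s / p))"
proof
  let ?D = "walled_cylinder i \<epsilon>"
  let ?N = "\<lambda>x. ball x (\<tau> * infdist x (frontier ?D))"
  let ?\<gamma> = "real CARD('n) - \<delta> * p"
  assume "\<exists>C > 0. \<forall>u \<in> Linf_on ?D. (\<integral>\<^sup>+x. ennreal (\<bar>u x - avg ?D u\<bar> powr s) \<partial>lebesgue_on ?D)
      \<le> ennreal C * enn_powr (frac_energy ?D ?N \<delta> p u) (s / p)"
  then obtain C where C: "0 < C"
    and ineq: "\<And>u. u \<in> Linf_on ?D \<Longrightarrow> (\<integral>\<^sup>+x. ennreal (\<bar>u x - avg ?D u\<bar> powr s) \<partial>lebesgue_on ?D)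
      \<le> ennreal C * enn_powr (frac_energy ?D ?N \<delta> p u) (s / p)" by blast
  obtain C' where C': "0 < C'" and energy: "\<And>j. frac_energy ?D ?N \<delta> p (room_function i j (3 * \<epsilon> j / (1 - \<tau>)))
      \<le> ennreal (C' * \<epsilon> j powr ?\<gamma>)"
    using frac_energy_room_function_le[OF l \<tau> \<delta> p] \<epsilon>(1) by blast
  define K where "K = C * C' powr (s / p) / (1 / 2) powr s"
  have bound: "real j + 1 \<le> K" for j
  proof -
    let ?R = "3 * \<epsilon> j / (1 - \<tau>)" and ?m = "room_size i j"
    let ?u = "room_function i j ?R"
    have R: "0 < ?R" "2 * ?R \<le> height (Suc j)" using \<epsilon>[of j] \<tau> by auto
    have m: "0 < ?m" by (rule room_size_pos)
    have "ennreal ((1 / 2) powr s * ?m) \<le> (\<integral>\<^sup>+x. ennreal (\<bar>?u x - avg ?D ?u\<bar> powr s) \<partial>lebesgue_on ?D)"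
      using s by (intro nn_integral_room_function_ge R) simp
    also have "\<dots> \<le> ennreal C * enn_powr (frac_energy ?D ?N \<delta> p ?u) (s / p)"
      by (rule ineq[OF room_function_Linf])
    also have "\<dots> \<le> ennreal C * ennreal ((C' * \<epsilon> j powr ?\<gamma>) powr (s / p))"
      using C' s p by (intro mult_left_mono enn_powr_mono energy) auto
    finally have "(1 / 2) powr s * ?m \<le> C * (C' * \<epsilon> j powr ?\<gamma>) powr (s / p)"
      using C by (simp flip: ennreal_mult)
    also have "(C' * \<epsilon> j powr ?\<gamma>) powr (s / p) = C' powr (s / p) * (\<epsilon> j powr (?\<gamma> / p)) powr s"
      using C' by (simp add: powr_mult powr_powr)
    also have "C * (C' powr (s / p) * (\<epsilon> j powr (?\<gamma> / p)) powr s) \<le> C * (C' powr (s / p) * (?m / (real j + 1)))"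
    proof (intro mult_left_mono)
      let ?e = "\<epsilon> j powr (?\<gamma> / p)"
      have e: "?e \<le> min 1 ?m / (real j + 1)" by (rule small)
      have "min 1 ?m / (real j + 1) \<le> 1" by (simp add: divide_le_eq)
      with e have e1: "?e \<le> 1" by linarith
      have "?e powr s \<le> ?e powr 1" using \<epsilon>(1)[of j] e1 s by (intro powr_mono') auto
      also have "\<dots> = ?e" by simp
      also have "\<dots> \<le> ?m / (real j + 1)" using e by (rule order_trans) (intro divide_right_mono, auto)
      finally show "?e powr s \<le> ?m / (real j + 1)" .
    qed (use C in auto)
    finally have "(1 / 2) powr s * ?m \<le> C * (C' powr (s / p) * (?m / (real j + 1)))" .
    then have "((1 / 2) powr s * (real j + 1)) * ?m \<le> (C * C' powr (s / p)) * ?m"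
      by (simp add: field_simps)
    then have "(1 / 2) powr s * (real j + 1) \<le> C * C' powr (s / p)"
      using m by (simp only: mult_le_cancel_right_pos)
    then show ?thesis unfolding K_def by (subst pos_le_divide_eq) (auto simp: mult.commute)
  qed
  obtain j :: nat where "K < real j" using reals_Archimedean2 by blast
  with bound[of j] show False by linarith
qed

theorem theorem3p1:
  fixes \<delta> \<tau> p q :: real
  assumes "CARD('n::finite) \<ge> 2"
    and "0 < \<delta>" "\<delta> < 1" "0 < \<tau>" "\<tau> < 1"
    and "1 < p" "1 < q"
    and "1 / p - 1 / q = \<delta> / real CARD('n)"
  shows "\<exists>D :: (real ^ 'n) set.
    bounded D \<and> euclid_domain D \<and>
    ahlfors_n_regular D \<and>
    (\<exists>C\<^sub>1::real. C\<^sub>1 > 0 \<and> (\<forall>u \<in> Lp_on D p.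
       (\<integral>\<^sup>+x. ennreal (\<bar>u x - avg D u\<bar> powr q) \<partial>lebesgue_on D)
         \<le> ennreal C\<^sub>1 * enn_powr (frac_energy D (\<lambda>x. D) \<delta> p u) (q / p))) \<and>
    \<not> (\<exists>C\<^sub>2::real. C\<^sub>2 > 0 \<and> (\<forall>u \<in> Linf_on D.
       (\<integral>\<^sup>+x. ennreal \<bar>u x - avg D u\<bar> \<partial>lebesgue_on D)
         \<le> ennreal C\<^sub>2 * enn_powr
              (frac_energy D (\<lambda>x. ball x (\<tau> * infdist x (frontier D))) \<delta> p u) (1 / p))) \<and>
    \<not> (\<exists>C::real. C > 0 \<and> (\<forall>u \<in> Linf_on D.
       (\<integral>\<^sup>+x. ennreal (\<bar>u x - avg D u\<bar> powr q) \<partial>lebesgue_on D)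
         \<le> ennreal C * enn_powr
              (frac_energy D (\<lambda>x. ball x (\<tau> * infdist x (frontier D))) \<delta> p u) (q / p)))"
proof -
  let ?n = "real CARD('n)"
  obtain i l :: 'n where l: "l \<noteq> i"
    using assms(1) card_le_Suc0_iff_eq[of "UNIV :: 'n set"] by fastforce
  define \<gamma> where "\<gamma> = (?n - \<delta> * p) / p"
  \<comment> \<open>The energy of wall j tends to 0 with its aperture because delta p is less than n.\<close>
  have "\<delta> / ?n < 1 / p" using assms(7,8) by (smt (verit) zero_less_divide_1_iff)
  then have \<gamma>: "0 < \<gamma>" using assms(6) by (simp add: \<gamma>_def field_simps)
  define m where "m j = min 1 (room_size i j) / (real j + 1)" for j
  have m: "0 < m j" for j using room_size_pos[of i j] by (simp add: m_def)
  \<comment> \<open>The first entry keeps the transition region of wall j above the next wall, the second makes its energy small against the room below.\<close>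
  define \<epsilon> where "\<epsilon> j = min ((1 - \<tau>) * height (Suc j) / 6) (m j powr (1 / \<gamma>))" for j
  have \<epsilon>_pos: "0 < \<epsilon> j" for j
    using m[of j] height_pos[of "Suc j"] assms(5) by (simp add: \<epsilon>_def)
  have \<epsilon>_le: "6 * \<epsilon> j / (1 - \<tau>) \<le> height (Suc j)" for j
  proof -
    have "\<epsilon> j \<le> (1 - \<tau>) * height (Suc j) / 6" by (simp add: \<epsilon>_def)
    then show ?thesis using assms(5) by (simp add: pos_divide_le_eq mult.commute)
  qed
  have \<epsilon>_small: "\<epsilon> j powr ((?n - \<delta> * p) / p) \<le> min 1 (room_size i j) / (real j + 1)" for j
  proof -
    have "\<epsilon> j powr \<gamma> \<le> (m j powr (1 / \<gamma>)) powr \<gamma>"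
      using \<epsilon>_pos[of j] \<gamma> by (intro powr_mono2) (auto simp: \<epsilon>_def)
    also have "\<dots> = m j" using \<gamma> m[of j] by (simp add: powr_powr)
    finally show ?thesis by (simp add: \<gamma>_def m_def)
  qed
  let ?D = "walled_cylinder i \<epsilon>"
  have "0 < measure lebesgue ?D"
    using measure_walled_Int[of UNIV i \<epsilon>] cylinder_part_pos[of UNIV "1 / 2" i] by simp
  moreover have "?D \<subseteq> cylinder i" by (auto simp: walled_cylinder_def)
  ultimately interpret conull_in_convex ?D "cylinder i"
    using open_walled_cylinder[of i \<epsilon>]
    by unfold_locales (auto simp: convex_cylinder bounded_cylinder negligible_walls)
  have "(1 / 2) *\<^sub>R axis i 1 \<in> ?D" by (rule axis_in_walled_cylinder[OF \<epsilon>_pos]) auto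
  then have dom: "euclid_domain ?D"
    using open_walled_cylinder connected_walled_cylinder[OF \<epsilon>_pos] by (auto simp: euclid_domain_def)
  have bdd: "bounded ?D" using bounded_cylinder D_subset by (rule bounded_subset)
  note no = no_improved_inequality[OF l assms(4,5,3,6) _ \<epsilon>_pos \<epsilon>_le \<epsilon>_small]
  show ?thesis
    using bdd dom ahlfors fractional_sobolev_poincare[OF assms(6,7,2,8)]
      no[of 1] no[of q] assms(7)
    by (intro exI[of _ ?D] conjI) auto
qed

end
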